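(* Suppose that $\Omega$ is bounded and $\Omega\cap\mathbb{R}^{n_1\times n_2\times n_3}_{++}$ is nonempty. Let $\{(\boldsymbol{y}^{(1),\ell},\dots,\boldsymbol{y}^{(N),\ell},W^{\ell})\}_{\ell\ge0}$ be the sequence generated by the dual block coordinate descent (BCD) method described in the context, and let $$X^{\ell}:=\exp\Big(\varepsilon^{-1}\Big(\sum_{i=1}^N\mathcal{A}^{(i,* )}\boldsymbol{y}^{(i),\ell}+W^{\ell}-M\Big)\Big).$$ Then the following statements hold. (i) $\{(\boldsymbol{y}^{(1),\ell},\dots,\boldsymbol{y}^{(N),\ell},W^{\ell})\}$ converges R-linearly to an optimal solution of the dual problem $(D)$ defined in the context. (ii) $\{X^{\ell}\}$ converges R-linearly to an optimal solution of the primal problem $(P)$ defined in the context.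
   Context: Setting. $\langle\cdot,\cdot\rangle$ is the standard inner product (on tensors or vectors). $\mathbb{R}_{+}^{n_1\times n_2\times n_3}$ (resp. $\mathbb{R}_{++}^{n_1\times n_2\times n_3}$) is the set of tensors with nonnegative (resp. positive) entries. Given are $C\in\mathbb{R}^{n_1\times n_2\times n_3}$, an upper bound $U\in\mathbb{R}_+^{n_1\times n_2\times n_3}\cup\{\infty\}^{n_1\times n_2\times n_3}$, vectors $\boldsymbol{b}^{(i)}\in\mathbb{R}^{m_i}$, and linear maps $\mathcal{A}^{(i)}:\mathbb{R}^{n_1\times n_2\times n_3}\to\mathbb{R}^{m_i}$, $\mathcal{A}^{(i)}(X)=(\langle A^{(i)}_1,X\rangle,\dots,\langle A^{(i)}_{m_i},X\rangle)^{\top}$, $i=1,\dots,N$, where for each $i$ the tensors $A^{(i)}_j\in\mathbb{R}^{n_1\times n_2\times n_3}$ have only entries in $\{0,1\}$ and satisfy $A^{(i)}_j\circ A^{(i)}_k=0$ for $j\ne k$ ($\circ$ = Hadamard product). The adjoint is $\mathcal{A}^{(i,* )}\boldsymbol{y}^{(i)}=\sum_{j=1}^{m_i}y^{(i)}_jA^{(i)}_j$. Define $\Omega=\{X:\ \mathcal{A}^{(i)}(X)=\boldsymbol{b}^{(i)},\ i=1,\dots,N,\ 0\le X\le U\}$. Let $\phi(X)=\sum_{r,s,t}(X_{rst}\log X_{rst}-X_{rst})$ with $0\log0=0$, $\mathrm{dom}\,\phi=\mathbb{R}_+^{n_1\times n_2\times n_3}$ ($\phi=+\infty$ elsewhere),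 and $\mathcal{D}_\phi(X,Y)=\phi(X)-\phi(Y)-\langle\nabla\phi(Y),X-Y\rangle$ for $Y\in\mathbb{R}_{++}^{n_1\times n_2\times n_3}$. Fix $S\in\mathbb{R}^{n_1\times n_2\times n_3}_{++}$ and $\varepsilon>0$; set $M:=C-\varepsilon\log S$ and $\widetilde M:=\exp(-M/\varepsilon)$. Here $\exp$ and $\log$ of tensors act entrywise. Primal problem $(P)$: $$\min_{X\in\mathbb{R}^{n_1\times n_2\times n_3}}\ \langle C,X\rangle+\varepsilon\,\mathcal{D}_\phi(X,S)\quad\text{s.t.}\quad \mathcal{A}^{(i)}(X)=\boldsymbol{b}^{(i)},\ i=1,\dots,N,\ \ X\le U.$$ Dual problem $(D)$ (over $\boldsymbol{y}^{(i)}\in\mathbb{R}^{m_i}$, $W\in\mathbb{R}^{n_1\times n_2\times n_3}$): minimize $$R(\boldsymbol{y}^{(1)},\dots,\boldsymbol{y}^{(N)},W):=\varepsilon\Big\langle\widetilde M,\exp\Big(\varepsilon^{-1}\Big(W+\sum_{i=1}^N\mathcal{A}^{(i,* )}\boldsymbol{y}^{(i)}\Big)\Big)\Big\rangle-\sum_{i=1}^N\langle\boldsymbol{y}^{(i)},\boldsymbol{b}^{(i)}\rangle-\langle W,U\rangle+\delta_-(W),$$ where $\delta_-$ is the indicator function ($0$ or $+\infty$) of $\{W: W\le0\}$; if $U$ has infinite entries, the convention $0\cdot\infty=0$ is used in $\langle W,U\rangle$. Dual BCD method. Choose $(\boldsymbol{y}^{(1),0},\dots,\boldsymbol{y}^{(N),0},W^0)\in\mathrm{dom}\,R$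 arbitrarily. For $\ell=0,1,2,\dots$ compute $$\boldsymbol{y}^{(i),\ell+1}=\arg\min_{\boldsymbol{y}^{(i)}}R(\boldsymbol{y}^{(1),\ell+1},\dots,\boldsymbol{y}^{(i-1),\ell+1},\boldsymbol{y}^{(i)},\boldsymbol{y}^{(i+1),\ell},\dots,\boldsymbol{y}^{(N),\ell},W^{\ell}),\quad i=1,\dots,N\ \text{(in this order)},$$ $$W^{\ell+1}=\arg\min_{W}R(\boldsymbol{y}^{(1),\ell+1},\dots,\boldsymbol{y}^{(N),\ell+1},W),$$ where each "$=\arg\min$" means that the left side is the unique minimizer. A sequence $\{x^\ell\}$ converges R-linearly to $x^*$ if there are constants $c>0$ and $q\in(0,1)$ with $\|x^\ell-x^*\|\le c\,q^\ell$ for all $\ell$. *)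

theory Defs
  imports "HOL-Analysis.Analysis"
begin

text \<open>The dimensions \<open>n\<^sub>1, n\<^sub>2, n\<^sub>3\<close> are the cardinalities of the three index types. Inner product,
  norm, the entrywise order and the Hadamard product (the componentwise \<open>*\<close>) are those of the
  library on iterated vectors; the strict order \<open><\<close> of the library is not entrywise, so entrywise
  positivity is a separate notion.\<close>

type_synonym ('a, 'b, 'c) tensor = "real ^ 'c ^ 'b ^ 'a"

type_synonym ('a, 'b, 'c) etensor = "ereal ^ 'c ^ 'b ^ 'a"

definition tmap :: "(real \<Rightarrow> real) \<Rightarrow> ('a::finite, 'b::finite, 'c::finite) tensor \<Rightarrow> ('a, 'b, 'c) tensor"
  where "tmap f X = (\<chi> r s t. f (X $ r $ s $ t))"

definition positive_tensor :: "('a::finite, 'b::finite, 'c::finite) tensor \<Rightarrow> bool"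
  where "positive_tensor X \<longleftrightarrow> (\<forall>r s t. 0 < X $ r $ s $ t)"

definition bounded_above_by ::
  "('a::finite, 'b::finite, 'c::finite) tensor \<Rightarrow> ('a, 'b, 'c) etensor \<Rightarrow> bool"
  where "bounded_above_by X U \<longleftrightarrow> (\<forall>r s t. ereal (X $ r $ s $ t) \<le> U $ r $ s $ t)"

text \<open>\<open>U\<close> is a real nonnegative tensor, or all of its entries are \<open>\<infinity>\<close>.\<close>

definition upper_bound_tensor :: "('a::finite, 'b::finite, 'c::finite) etensor \<Rightarrow> bool"
  where "upper_bound_tensor U \<longleftrightarrow>
    (\<forall>r s t. \<exists>u::real. 0 \<le> u \<and> U $ r $ s $ t = ereal u) \<or> (\<forall>r s t. U $ r $ s $ t = \<infinity>)"

text \<open>A vector in \<open>\<real>\<^sup>m\<close> is a function on \<open>nat\<close> vanishing off \<open>{1..m}\<close>. A family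
  \<open>(y\<^sup>(\<^sup>1\<^sup>), \<dots>, y\<^sup>(\<^sup>N\<^sup>))\<close> in \<open>\<real>\<^bsup>m 1\<^esup> \<times> \<dots> \<times> \<real>\<^bsup>m N\<^esup>\<close> is a function on \<open>nat\<close> whose \<open>i\<close>-th value is such a
  vector for \<open>i \<in> {1..N}\<close> and zero otherwise.\<close>

definition rvec :: "nat \<Rightarrow> (nat \<Rightarrow> real) set"
  where "rvec m = {v. \<forall>j. j \<notin> {1..m} \<longrightarrow> v j = 0}"

definition blocks :: "nat \<Rightarrow> (nat \<Rightarrow> nat) \<Rightarrow> (nat \<Rightarrow> nat \<Rightarrow> real) set"
  where "blocks N m =
    {y. (\<forall>i\<in>{1..N}. y i \<in> rvec (m i)) \<and> (\<forall>i. i \<notin> {1..N} \<longrightarrow> y i = (\<lambda>j. 0))}"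

definition dual_norm ::
  "nat \<Rightarrow> (nat \<Rightarrow> nat) \<Rightarrow> (nat \<Rightarrow> nat \<Rightarrow> real) \<times> ('a::finite, 'b::finite, 'c::finite) tensor \<Rightarrow> real"
  where "dual_norm N m = (\<lambda>(y, W). sqrt ((\<Sum>i=1..N. \<Sum>j=1..m i. (y i j)\<^sup>2) + (norm W)\<^sup>2))"

definition lin_map ::
  "nat \<Rightarrow> (nat \<Rightarrow> ('a::finite, 'b::finite, 'c::finite) tensor) \<Rightarrow> ('a, 'b, 'c) tensor \<Rightarrow> (nat \<Rightarrow> real)"
  where "lin_map m A X = (\<lambda>j. if j \<in> {1..m} then A j \<bullet> X else 0)"

definition adjoint_map ::
  "nat \<Rightarrow> (nat \<Rightarrow> ('a::finite, 'b::finite, 'c::finite) tensor) \<Rightarrow> (nat \<Rightarrow> real) \<Rightarrow> ('a, 'b, 'c) tensor"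
  where "adjoint_map m A v = (\<Sum>j=1..m. v j *\<^sub>R A j)"

definition feasible_set ::
  "nat \<Rightarrow> (nat \<Rightarrow> nat) \<Rightarrow> (nat \<Rightarrow> nat \<Rightarrow> ('a::finite, 'b::finite, 'c::finite) tensor) \<Rightarrow>
   (nat \<Rightarrow> nat \<Rightarrow> real) \<Rightarrow> ('a, 'b, 'c) etensor \<Rightarrow> ('a, 'b, 'c) tensor set"
  where "feasible_set N m A b U =
    {X. (\<forall>i\<in>{1..N}. lin_map (m i) (A i) X = b i) \<and> 0 \<le> X \<and> bounded_above_by X U}"

text \<open>The library has \<open>ln 0 = 0\<close>, so \<open>0 log 0 = 0\<close> holds without a case distinction.\<close>

definition entropy :: "('a::finite, 'b::finite, 'c::finite) tensor \<Rightarrow> ereal"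
  where "entropy X =
    (if 0 \<le> X
     then ereal (\<Sum>r\<in>UNIV. \<Sum>s\<in>UNIV. \<Sum>t\<in>UNIV.
            X $ r $ s $ t * ln (X $ r $ s $ t) - X $ r $ s $ t)
     else \<infinity>)"

text \<open>Gradient of an extended-valued function, at a point in the interior of its domain.\<close>

definition gradient :: "('v::real_inner \<Rightarrow> ereal) \<Rightarrow> 'v \<Rightarrow> 'v"
  where "gradient f x = (THE D. GDERIV (\<lambda>z. real_of_ereal (f z)) x :> D)"

definition bregman :: "('v::real_inner \<Rightarrow> ereal) \<Rightarrow> 'v \<Rightarrow> 'v \<Rightarrow> ereal"
  where "bregman f x y = f x - f y - ereal (gradient f y \<bullet> (x - y))"

definition primal_obj ::
  "('a::finite, 'b::finite, 'c::finite) tensor \<Rightarrow> real \<Rightarrow> ('a, 'b, 'c) tensor \<Rightarrow>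
   ('a, 'b, 'c) tensor \<Rightarrow> ereal"
  where "primal_obj C \<epsilon> S X = ereal (C \<bullet> X) + ereal \<epsilon> * bregman entropy X S"

definition primal_optimal ::
  "('a::finite, 'b::finite, 'c::finite) tensor \<Rightarrow> real \<Rightarrow> ('a, 'b, 'c) tensor \<Rightarrow>
   nat \<Rightarrow> (nat \<Rightarrow> nat) \<Rightarrow> (nat \<Rightarrow> nat \<Rightarrow> ('a, 'b, 'c) tensor) \<Rightarrow> (nat \<Rightarrow> nat \<Rightarrow> real) \<Rightarrow>
   ('a, 'b, 'c) etensor \<Rightarrow> ('a, 'b, 'c) tensor \<Rightarrow> bool"
  where "primal_optimal C \<epsilon> S N m A b U X \<longleftrightarrow>
    is_arg_min (primal_obj C \<epsilon> S)
      (\<lambda>Z. (\<forall>i\<in>{1..N}. lin_map (m i) (A i) Z = b i) \<and> bounded_above_by Z U) X"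

text \<open>Multiplication on \<open>ereal\<close> satisfies \<open>0 * \<infinity> = 0\<close>. For \<open>W \<le> 0\<close> all summands of the pairing have
  the same sign; otherwise the indicator below dominates, since \<open>x + \<infinity> = \<infinity>\<close> for all \<open>x\<close>.\<close>

definition extended_inner ::
  "('a::finite, 'b::finite, 'c::finite) tensor \<Rightarrow> ('a, 'b, 'c) etensor \<Rightarrow> ereal"
  where "extended_inner W U =
    (\<Sum>r\<in>UNIV. \<Sum>s\<in>UNIV. \<Sum>t\<in>UNIV. ereal (W $ r $ s $ t) * U $ r $ s $ t)"

definition indicator_nonpos :: "('a::finite, 'b::finite, 'c::finite) tensor \<Rightarrow> ereal"
  where "indicator_nonpos W = (if W \<le> 0 then 0 else \<infinity>)"

definition dual_obj ::
  "('a::finite, 'b::finite, 'c::finite) tensor \<Rightarrow> real \<Rightarrow> nat \<Rightarrow> (nat \<Rightarrow> nat) \<Rightarrow>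
   (nat \<Rightarrow> nat \<Rightarrow> ('a, 'b, 'c) tensor) \<Rightarrow> (nat \<Rightarrow> nat \<Rightarrow> real) \<Rightarrow> ('a, 'b, 'c) etensor \<Rightarrow>
   (nat \<Rightarrow> nat \<Rightarrow> real) \<Rightarrow> ('a, 'b, 'c) tensor \<Rightarrow> ereal"
  where "dual_obj Mt \<epsilon> N m A b U y W =
    ereal (\<epsilon> * (Mt \<bullet> tmap exp ((1 / \<epsilon>) *\<^sub>R (W + (\<Sum>i=1..N. adjoint_map (m i) (A i) (y i)))))
           - (\<Sum>i=1..N. \<Sum>j=1..m i. y i j * b i j))
    - extended_inner W U + indicator_nonpos W"

definition dual_optimal ::
  "('a::finite, 'b::finite, 'c::finite) tensor \<Rightarrow> real \<Rightarrow> nat \<Rightarrow> (nat \<Rightarrow> nat) \<Rightarrow>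
   (nat \<Rightarrow> nat \<Rightarrow> ('a, 'b, 'c) tensor) \<Rightarrow> (nat \<Rightarrow> nat \<Rightarrow> real) \<Rightarrow> ('a, 'b, 'c) etensor \<Rightarrow>
   (nat \<Rightarrow> nat \<Rightarrow> real) \<times> ('a, 'b, 'c) tensor \<Rightarrow> bool"
  where "dual_optimal Mt \<epsilon> N m A b U p \<longleftrightarrow>
    is_arg_min (\<lambda>(y, W). dual_obj Mt \<epsilon> N m A b U y W) (\<lambda>(y, W). y \<in> blocks N m) p"

definition is_unique_arg_min :: "('v \<Rightarrow> ereal) \<Rightarrow> 'v set \<Rightarrow> 'v \<Rightarrow> bool"
  where "is_unique_arg_min f S x \<longleftrightarrow>
    is_arg_min f (\<lambda>z. z \<in> S) x \<and> (\<forall>z. is_arg_min f (\<lambda>z. z \<in> S) z \<longrightarrow> z = x)"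

text \<open>Here \<open>y l i\<close> is the \<open>i\<close>-th block of the \<open>l\<close>-th iterate.\<close>

definition dual_bcd_sequence ::
  "('a::finite, 'b::finite, 'c::finite) tensor \<Rightarrow> real \<Rightarrow> nat \<Rightarrow> (nat \<Rightarrow> nat) \<Rightarrow>
   (nat \<Rightarrow> nat \<Rightarrow> ('a, 'b, 'c) tensor) \<Rightarrow> (nat \<Rightarrow> nat \<Rightarrow> real) \<Rightarrow> ('a, 'b, 'c) etensor \<Rightarrow>
   (nat \<Rightarrow> nat \<Rightarrow> nat \<Rightarrow> real) \<Rightarrow> (nat \<Rightarrow> ('a, 'b, 'c) tensor) \<Rightarrow> bool"
  where "dual_bcd_sequence Mt \<epsilon> N m A b U y W \<longleftrightarrow>
    (\<forall>l. y l \<in> blocks N m) \<and>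
    dual_obj Mt \<epsilon> N m A b U (y 0) (W 0) < \<infinity> \<and>
    (\<forall>l. (\<forall>i\<in>{1..N}.
            is_unique_arg_min
              (\<lambda>v. dual_obj Mt \<epsilon> N m A b U
                     (\<lambda>k. if k < i then y (Suc l) k else if k = i then v else y l k) (W l))
              (rvec (m i)) (y (Suc l) i)) \<and>
         is_unique_arg_min (\<lambda>V. dual_obj Mt \<epsilon> N m A b U (y (Suc l)) V) UNIV (W (Suc l)))"

definition R_linearly_converges :: "('v::minus \<Rightarrow> real) \<Rightarrow> (nat \<Rightarrow> 'v) \<Rightarrow> 'v \<Rightarrow> bool"
  where "R_linearly_converges nrm x xs \<longleftrightarrow>
    (\<exists>c>0. \<exists>q. 0 < q \<and> q < 1 \<and> (\<forall>l. nrm (x l - xs) \<le> c * q ^ l))"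

end

theory Submission
  imports Defs
begin

text \<open>Collecting the multipliers and \<open>W\<close> into one vector \<open>x\<close>, the dual objective becomes, up to the factor
  \<open>\<epsilon>\<close>, a function \<open>F x = (\<Sum>k. \<mu> k * exp (z x k)) - (\<Sum>p. x p * \<beta> p)\<close> with \<open>z\<close> linear, under the sign
  constraints \<open>x p \<le> 0\<close> for the coordinates coming from \<open>W\<close>; an infinite \<open>U\<close> just removes these
  coordinates. A positive primal point bounds \<open>z\<close> on sublevel sets, so there the exponentials are
  strongly convex and have Lipschitz gradients in \<open>z\<close>, although \<open>F\<close> need not be strictly convex in \<open>x\<close>.
  Hoffman's error bound for the solution polyhedron restores quadratic growth: the distance to the
  solution set squared is at most a multiple of the gap in value. Exact block minimization decreases
  \<open>F\<close> by a multiple of the squared step, because the columns of a block have disjoint supports and are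
  nonzero by uniqueness of the block minimizers. First-order optimality of the intermediate points
  bounds the gap by step length times distance to the solution set. Hence the gap after a sweep is
  at most a multiple of the decrease in that sweep, which makes gaps, steps and finally the iterates
  converge geometrically. The limit satisfies the optimality conditions, and convexity of the
  entropy turns them into primal optimality.\<close>

section \<open>Hoffman's error bound\<close>

text \<open>Clipping \<open>x\<close> from above by \<open>V\<close> and then from below by
  \<open>L\<close> moves it by at most \<open>w\<close>, because no bound is violated by more than
  \<open>w\<close>. This supplies the value of the variable eliminated below.\<close>

lemma clamp_exists:
  fixes x w :: real
  assumes "finite L" "finite V" "\<And>l u. l \<in> L \<Longrightarrow> u \<in> V \<Longrightarrow> l \<le> u"
    and "\<And>l. l \<in> L \<Longrightarrow> l \<le> x + w" "\<And>u. u \<in> V \<Longrightarrow> x - w \<le> u" "0 \<le> w"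
  shows "\<exists>t. (\<forall>l\<in>L. l \<le> t) \<and> (\<forall>u\<in>V. t \<le> u) \<and> \<bar>x - t\<bar> \<le> w"
proof -
  define m where "m = Min (insert x V)"
  have m: "m \<le> x" "x - w \<le> m" "\<And>u. u \<in> V \<Longrightarrow> m \<le> u"
    unfolding m_def using assms by auto
  define t where "t = Max (insert m L)"
  have "l \<le> t" if "l \<in> L" for l unfolding t_def using assms that by auto
  moreover have "t \<le> u" if "u \<in> V" for u unfolding t_def using assms m that by auto
  moreover have "x - w \<le> t" "t \<le> x + w" unfolding t_def using assms m
    by (auto simp: Max_ge_iff)
  ultimately show ?thesis by (auto simp: abs_le_iff intro!: exI[of _ t])
qed

text \<open>Fourier--Motzkin elimination. The right-hand sides depend on a parameter \<open>c\<close>, and the constant \<open>H\<close>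
  is uniform in \<open>c\<close>.\<close>

lemma hoffman:
  fixes R :: "(('p \<Rightarrow> real) \<times> ('c \<Rightarrow> real)) set"
  assumes "finite P" "finite R"
  shows "\<exists>H\<ge>0. \<forall>c x v. 0 \<le> v \<longrightarrow> (\<forall>(\<alpha>, \<kappa>)\<in>R. (\<Sum>p\<in>P. \<alpha> p * x p) \<le> \<kappa> c + v) \<longrightarrow>
    (\<exists>y. \<forall>(\<alpha>, \<kappa>)\<in>R. (\<Sum>p\<in>P. \<alpha> p * y p) \<le> \<kappa> c) \<longrightarrow>
    (\<exists>y. (\<forall>(\<alpha>, \<kappa>)\<in>R. (\<Sum>p\<in>P. \<alpha> p * y p) \<le> \<kappa> c) \<and> (\<forall>p\<in>P. \<bar>x p - y p\<bar> \<le> H * v))"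
  using assms
proof (induction P arbitrary: R rule: finite_induct)
  case empty
  then show ?case by (intro exI[of _ 0]) auto
next
  case (insert q P)
  \<comment> \<open>Divided by its coefficient at \<open>q\<close>, a row bounds the variable
    \<open>q\<close> from above if the coefficient is positive and from below if it is negative.
    \<open>comb\<close> says that the lower bound does not exceed the upper one, which no longer
    involves \<open>q\<close>.\<close>
  define comb :: "(('p \<Rightarrow> real) \<times> ('c \<Rightarrow> real)) \<times> (('p \<Rightarrow> real) \<times> ('c \<Rightarrow> real)) \<Rightarrow> _"
    where "comb = (\<lambda>((\<alpha>, \<kappa>), (\<alpha>', \<kappa>')). ((\<lambda>p. \<alpha> p / \<alpha> q - \<alpha>' p / \<alpha>' q), (\<lambda>c. \<kappa> c / \<alpha> q - \<kappa>' c / \<alpha>' q)))"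
  define R0 where "R0 = {r \<in> R. fst r q = 0}"
  define R1 where "R1 = {r \<in> R. fst r q > 0}"
  define R2 where "R2 = {r \<in> R. fst r q < 0}"
  have fin: "finite R0" "finite R1" "finite R2" unfolding R0_def R1_def R2_def using insert by auto
  have "finite (R0 \<union> comb ` (R1 \<times> R2))" using fin by auto
  from insert.IH[OF this] obtain H where H: "H \<ge> 0"
    "\<And>c x v. 0 \<le> v \<Longrightarrow> \<forall>(\<alpha>, \<kappa>)\<in>R0 \<union> comb ` (R1 \<times> R2). (\<Sum>p\<in>P. \<alpha> p * x p) \<le> \<kappa> c + v \<Longrightarrow>
    \<exists>y. \<forall>(\<alpha>, \<kappa>)\<in>R0 \<union> comb ` (R1 \<times> R2). (\<Sum>p\<in>P. \<alpha> p * y p) \<le> \<kappa> c \<Longrightarrow>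
    \<exists>y. (\<forall>(\<alpha>, \<kappa>)\<in>R0 \<union> comb ` (R1 \<times> R2). (\<Sum>p\<in>P. \<alpha> p * y p) \<le> \<kappa> c) \<and> (\<forall>p\<in>P. \<bar>x p - y p\<bar> \<le> H * v)"
    by blast
  \<comment> \<open>Uniform bounds over all rows: \<open>\<gamma>\<close> for the reciprocal
    coefficients at \<open>q\<close>, \<open>T\<close> for the l1-norms on \<open>P\<close>. Rows in
    \<open>R0\<close> contribute \<open>1 / 0 = 0\<close> to \<open>\<gamma>\<close>.\<close>
  define \<gamma> where "\<gamma> = 1 + (\<Sum>r\<in>R. 1 / \<bar>fst r q\<bar>)"
  define T where "T = (\<Sum>r\<in>R. \<Sum>p\<in>P. \<bar>fst r p\<bar>)"
  have \<gamma>1: "1 \<le> \<gamma>" unfolding \<gamma>_def by (simp add: sum_nonneg)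
  have \<gamma>: "1 / \<bar>fst r q\<bar> \<le> \<gamma>" if "r \<in> R" for r
    using member_le_sum[of r R "\<lambda>r. 1 / \<bar>fst r q\<bar>"] that insert unfolding \<gamma>_def by auto
  have T0: "T \<ge> 0" unfolding T_def by (intro sum_nonneg) auto
  have T: "(\<Sum>p\<in>P. \<bar>fst r p\<bar>) \<le> T" if "r \<in> R" for r
    using member_le_sum[of r R "\<lambda>r. \<Sum>p\<in>P. \<bar>fst r p\<bar>"] that insert unfolding T_def
    by (auto intro: sum_nonneg)
  \<comment> \<open>\<open>H1\<close> bounds the displacement on \<open>P\<close>, since
    \<open>x\<close> violates combined rows by at most \<open>2 * \<gamma> * v\<close>.
    \<open>H2\<close> bounds that of \<open>q\<close>: the displacement on \<open>P\<close> adds at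
    most \<open>T * H1 * v\<close> to the violation \<open>v\<close> of a row, and dividing by the
    coefficient at \<open>q\<close> costs a factor \<open>\<gamma>\<close>.\<close>
  define H1 where "H1 = H * (2 * \<gamma>)"
  have H10: "H1 \<ge> 0" unfolding H1_def using H \<gamma>1 by auto
  define H2 where "H2 = \<gamma> * (1 + T * H1)"
  have H20: "H2 \<ge> 0" unfolding H2_def using H10 \<gamma>1 T0 by auto
  show ?case
  proof (intro exI[of _ "max H1 H2"] conjI allI impI)
    show "0 \<le> max H1 H2" using H10 by auto
    fix c :: 'c and x :: "'p \<Rightarrow> real" and v :: real
    assume v: "0 \<le> v"
      and x: "\<forall>(\<alpha>, \<kappa>)\<in>R. (\<Sum>p\<in>insert q P. \<alpha> p * x p) \<le> \<kappa> c + v"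
      and "\<exists>y. \<forall>(\<alpha>, \<kappa>)\<in>R. (\<Sum>p\<in>insert q P. \<alpha> p * y p) \<le> \<kappa> c"
    then obtain y where y: "\<forall>(\<alpha>, \<kappa>)\<in>R. (\<Sum>p\<in>insert q P. \<alpha> p * y p) \<le> \<kappa> c" by blast
    have combsum: "(\<Sum>p\<in>P. fst (comb (r, s)) p * u p)
        = (\<Sum>p\<in>P. fst r p * u p) / fst r q + (\<Sum>p\<in>P. fst s p * u p) / (- fst s q)" for r s u
      unfolding comb_def by (auto simp: case_prod_beta sum_divide_distrib sum_subtractf algebra_simps)
    have row: "(\<Sum>p\<in>P. fst r p * x p) + fst r q * x q \<le> snd r c + v"
      "(\<Sum>p\<in>P. fst r p * y p) + fst r q * y q \<le> snd r c" if "r \<in> R" for r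
      using x y that insert by (auto simp: case_prod_beta add.commute)
    \<comment> \<open>Needed twice: \<open>e = 0\<close> shows that the reduced system is solvable,
      \<open>e = v\<close> bounds its violation at \<open>x\<close>.\<close>
    have up: "(\<Sum>p\<in>P. fst (comb (r, s)) p * u p) \<le> snd (comb (r, s)) c + e * (2 * \<gamma>)"
      if rs: "r \<in> R1" "s \<in> R2" and e: "e \<ge> 0"
        and u: "\<And>r. r \<in> R \<Longrightarrow> (\<Sum>p\<in>P. fst r p * u p) + fst r q * u q \<le> snd r c + e" for r s u e
    proof -
      have r: "r \<in> R" "fst r q > 0" and s: "s \<in> R" "fst s q < 0"
        using rs unfolding R1_def R2_def by auto
      have "(\<Sum>p\<in>P. fst r p * u p) / fst r q \<le> (snd r c + e - fst r q * u q) / fst r q"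
        using u[OF r(1)] r by (intro divide_right_mono) auto
      also have "\<dots> = snd r c / fst r q - u q + e * (1 / \<bar>fst r q\<bar>)" using r by (simp add: field_simps)
      also have "\<dots> \<le> snd r c / fst r q - u q + e * \<gamma>"
        using \<gamma>[OF r(1)] e by (intro add_left_mono mult_left_mono) auto
      finally have 1: "(\<Sum>p\<in>P. fst r p * u p) / fst r q \<le> snd r c / fst r q - u q + e * \<gamma>" .
      have "(\<Sum>p\<in>P. fst s p * u p) / (- fst s q) \<le> (snd s c + e - fst s q * u q) / (- fst s q)"
        using u[OF s(1)] s by (intro divide_right_mono) auto
      also have "\<dots> = - snd s c / fst s q + u q + e * (1 / \<bar>fst s q\<bar>)" using s by (simp add: field_simps)
      also have "\<dots> \<le> - snd s c / fst s q + u q + e * \<gamma>"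
        using \<gamma>[OF s(1)] e by (intro add_left_mono mult_left_mono) auto
      finally have 2: "(\<Sum>p\<in>P. fst s p * u p) / (- fst s q) \<le> - snd s c / fst s q + u q + e * \<gamma>" .
      have "snd (comb (r, s)) c = snd r c / fst r q - snd s c / fst s q"
        unfolding comb_def by (auto simp: case_prod_beta)
      with 1 2 show ?thesis unfolding combsum by (simp add: algebra_simps)
    qed
    have ex: "\<exists>y. \<forall>(\<alpha>, \<kappa>)\<in>R0 \<union> comb ` (R1 \<times> R2). (\<Sum>p\<in>P. \<alpha> p * y p) \<le> \<kappa> c"
    proof (intro exI[of _ y] ballI, clarify)
      fix \<alpha> \<kappa> assume "(\<alpha>, \<kappa>) \<in> R0 \<union> comb ` (R1 \<times> R2)"
      then consider "(\<alpha>, \<kappa>) \<in> R0" | r s where "r \<in> R1" "s \<in> R2" "(\<alpha>, \<kappa>) = comb (r, s)" by auto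
      then show "(\<Sum>p\<in>P. \<alpha> p * y p) \<le> \<kappa> c"
      proof cases
        case 1 then show ?thesis using row(2)[of "(\<alpha>, \<kappa>)"] unfolding R0_def by auto
      next
        case 2 show ?thesis using up[OF 2(1,2), of 0 y] row(2) 2(3)[symmetric] by auto
      qed
    qed
    have "\<forall>(\<alpha>, \<kappa>)\<in>R0 \<union> comb ` (R1 \<times> R2). (\<Sum>p\<in>P. \<alpha> p * x p) \<le> \<kappa> c + v * (2 * \<gamma>)"
    proof (intro ballI, clarify)
      fix \<alpha> \<kappa> assume "(\<alpha>, \<kappa>) \<in> R0 \<union> comb ` (R1 \<times> R2)"
      then consider "(\<alpha>, \<kappa>) \<in> R0" | r s where "r \<in> R1" "s \<in> R2" "(\<alpha>, \<kappa>) = comb (r, s)" by auto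
      then show "(\<Sum>p\<in>P. \<alpha> p * x p) \<le> \<kappa> c + v * (2 * \<gamma>)"
      proof cases
        case 1
        then have "(\<Sum>p\<in>P. \<alpha> p * x p) \<le> \<kappa> c + v * 1"
          using row(1)[of "(\<alpha>, \<kappa>)"] unfolding R0_def by auto
        also have "\<dots> \<le> \<kappa> c + v * (2 * \<gamma>)" using \<gamma>1 v by (intro add_left_mono mult_left_mono) auto
        finally show ?thesis .
      next
        case 2 show ?thesis using up[OF 2(1,2) v, of x] row(1) 2(3)[symmetric] by auto
      qed
    qed
    from H(2)[OF _ this ex] v \<gamma>1 obtain y' where
      y': "\<forall>(\<alpha>, \<kappa>)\<in>R0 \<union> comb ` (R1 \<times> R2). (\<Sum>p\<in>P. \<alpha> p * y' p) \<le> \<kappa> c"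
      and "\<forall>p\<in>P. \<bar>x p - y' p\<bar> \<le> H * (v * (2 * \<gamma>))" by auto
    then have d: "\<bar>x p - y' p\<bar> \<le> H1 * v" if "p \<in> P" for p
      using that unfolding H1_def by (auto simp: algebra_simps)
    \<comment> \<open>The value of coordinate \<open>q\<close> at which row \<open>r\<close> becomes
      tight when the others are given by \<open>y'\<close>: an upper bound for rows in
      \<open>R1\<close>, a lower bound for rows in \<open>R2\<close>.\<close>
    define bd where "bd r = (snd r c - (\<Sum>p\<in>P. fst r p * y' p)) / fst r q" for r :: "('p \<Rightarrow> real) \<times> ('c \<Rightarrow> real)"
    have excess: "((\<Sum>p\<in>P. fst r p * y' p) + fst r q * x q - snd r c) * (1 / \<bar>fst r q\<bar>) \<le> H2 * v"
      if r: "r \<in> R" for r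
    proof -
      have "(\<Sum>p\<in>P. fst r p * y' p) - (\<Sum>p\<in>P. fst r p * x p) = (\<Sum>p\<in>P. fst r p * (y' p - x p))"
        by (simp add: sum_subtractf algebra_simps)
      also have "\<dots> \<le> (\<Sum>p\<in>P. \<bar>fst r p\<bar> * (H1 * v))"
      proof (rule sum_mono)
        fix p assume "p \<in> P"
        have "fst r p * (y' p - x p) \<le> \<bar>fst r p\<bar> * \<bar>x p - y' p\<bar>"
          by (metis abs_ge_self abs_minus_commute abs_mult)
        also have "\<dots> \<le> \<bar>fst r p\<bar> * (H1 * v)" using d[OF \<open>p \<in> P\<close>] by (intro mult_left_mono) auto
        finally show "fst r p * (y' p - x p) \<le> \<bar>fst r p\<bar> * (H1 * v)" .
      qed
      also have "\<dots> = (\<Sum>p\<in>P. \<bar>fst r p\<bar>) * (H1 * v)" by (simp add: sum_distrib_right)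
      also have "\<dots> \<le> T * (H1 * v)" using T[OF r] H10 v by (intro mult_right_mono) auto
      finally have "(\<Sum>p\<in>P. fst r p * y' p) + fst r q * x q - snd r c \<le> (1 + T * H1) * v"
        using row(1)[OF r] by (simp add: algebra_simps)
      then have "((\<Sum>p\<in>P. fst r p * y' p) + fst r q * x q - snd r c) * (1 / \<bar>fst r q\<bar>)
          \<le> ((1 + T * H1) * v) * (1 / \<bar>fst r q\<bar>)" by (intro mult_right_mono) auto
      also have "\<dots> \<le> ((1 + T * H1) * v) * \<gamma>"
        using \<gamma>[OF r] T0 H10 v by (intro mult_left_mono) auto
      finally show ?thesis unfolding H2_def by (simp add: algebra_simps)
    qed
    have "\<exists>t. (\<forall>l\<in>bd ` R2. l \<le> t) \<and> (\<forall>u\<in>bd ` R1. t \<le> u) \<and> \<bar>x q - t\<bar> \<le> H2 * v"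
    proof (rule clamp_exists)
      show "finite (bd ` R2)" "finite (bd ` R1)" using fin by auto
      show "0 \<le> H2 * v" using H20 v by auto
      fix l u assume "l \<in> bd ` R2" "u \<in> bd ` R1"
      then obtain r s where rs: "r \<in> R1" "u = bd r" "s \<in> R2" "l = bd s" by auto
      have "comb (r, s) \<in> comb ` (R1 \<times> R2)" using rs by auto
      then have "(\<Sum>p\<in>P. fst (comb (r, s)) p * y' p) \<le> snd (comb (r, s)) c"
        using y' by (auto simp: case_prod_beta)
      moreover have "snd (comb (r, s)) c = snd r c / fst r q - snd s c / fst s q"
        unfolding comb_def by (auto simp: case_prod_beta)
      ultimately show "l \<le> u" unfolding combsum rs bd_def by (simp add: diff_divide_distrib)
    next
      fix l assume "l \<in> bd ` R2"
      then obtain s where s: "s \<in> R" "fst s q < 0" "l = bd s" unfolding R2_def by auto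
      show "l \<le> x q + H2 * v" using excess[OF s(1)] s(2) unfolding s(3) bd_def by (simp add: field_simps)
    next
      fix u assume "u \<in> bd ` R1"
      then obtain s where s: "s \<in> R" "fst s q > 0" "u = bd s" unfolding R1_def by auto
      show "x q - H2 * v \<le> u" using excess[OF s(1)] s(2) unfolding s(3) bd_def by (simp add: field_simps)
    qed
    then obtain t where t: "\<forall>l\<in>bd ` R2. l \<le> t" "\<forall>u\<in>bd ` R1. t \<le> u" "\<bar>x q - t\<bar> \<le> H2 * v" by blast
    have mx: "H1 * v \<le> max H1 H2 * v" "H2 * v \<le> max H1 H2 * v" using v by (auto intro: mult_right_mono)
    show "\<exists>y. (\<forall>(\<alpha>, \<kappa>)\<in>R. (\<Sum>p\<in>insert q P. \<alpha> p * y p) \<le> \<kappa> c) \<and>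
        (\<forall>p\<in>insert q P. \<bar>x p - y p\<bar> \<le> max H1 H2 * v)"
    proof (intro exI[of _ "y'(q := t)"] conjI ballI, clarify)
      fix \<alpha> \<kappa> assume r: "(\<alpha>, \<kappa>) \<in> R"
      have s: "(\<Sum>p\<in>insert q P. \<alpha> p * (y'(q := t)) p) = \<alpha> q * t + (\<Sum>p\<in>P. \<alpha> p * y' p)"
        using insert by (auto intro!: sum.cong)
      consider "\<alpha> q = 0" | "\<alpha> q > 0" | "\<alpha> q < 0" by linarith
      then show "(\<Sum>p\<in>insert q P. \<alpha> p * (y'(q := t)) p) \<le> \<kappa> c"
      proof cases
        case 1
        then have "(\<alpha>, \<kappa>) \<in> R0" using r unfolding R0_def by auto
        then show ?thesis using y' 1 unfolding s by auto
      next
        case 2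
        then have "(\<alpha>, \<kappa>) \<in> R1" using r unfolding R1_def by auto
        then have "t \<le> bd (\<alpha>, \<kappa>)" using t(2) by auto
        then show ?thesis using 2 unfolding s bd_def by (simp add: field_simps)
      next
        case 3
        then have "(\<alpha>, \<kappa>) \<in> R2" using r unfolding R2_def by auto
        then have "bd (\<alpha>, \<kappa>) \<le> t" using t(1) by auto
        then show ?thesis using 3 unfolding s bd_def by (simp add: field_simps)
      qed
    next
      fix p assume "p \<in> insert q P"
      then show "\<bar>x p - (y'(q := t)) p\<bar> \<le> max H1 H2 * v"
        using t(3) d[of p] mx insert(2) by auto
    qed
  qed
qed

section \<open>Exponential programs with sign constraints\<close>

lemma exp_bregman_lower:
  fixes s t B :: real
  assumes "\<bar>s\<bar> \<le> B" "\<bar>t\<bar> \<le> B"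
  shows "exp (- (3 * B)) / 2 * (s - t)\<^sup>2 \<le> exp s - exp t - exp t * (s - t)"
proof -
  obtain u where u: "\<bar>u\<bar> \<le> \<bar>s - t\<bar>"
    "exp (s - t) = (\<Sum>m<2. ((s - t) ^ m) / fact m) + (exp u / fact 2) * (s - t)\<^sup>2"
    using Maclaurin_exp_le[of "s - t" 2] by blast
  have "exp (s - t) = 1 + (s - t) + exp u / 2 * (s - t)\<^sup>2"
    using u(2) by (simp add: numeral_2_eq_2)
  then have "exp s = exp t * (1 + (s - t) + exp u / 2 * (s - t)\<^sup>2)"
    by (metis add.commute diff_add_cancel exp_add)
  then have "exp s - exp t - exp t * (s - t) = exp (t + u) / 2 * (s - t)\<^sup>2"
    by (simp add: exp_add algebra_simps)
  \<comment> \<open>The Taylor point satisfies \<open>t + u \<ge> - (3 * B)\<close>, because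
    \<open>u\<close> is at most \<open>2 * B\<close> in absolute value.\<close>
  moreover have "exp (- (3 * B)) / 2 * (s - t)\<^sup>2 \<le> exp (t + u) / 2 * (s - t)\<^sup>2"
    using assms u(1) by (intro mult_right_mono divide_right_mono) auto
  ultimately show ?thesis by simp
qed

lemma exp_bregman_nonneg:
  fixes s t :: real
  shows "0 \<le> exp s - exp t - exp t * (s - t)"
proof -
  have "0 \<le> exp (- (3 * max \<bar>s\<bar> \<bar>t\<bar>)) / 2 * (s - t)\<^sup>2" by simp
  also have "\<dots> \<le> exp s - exp t - exp t * (s - t)" by (rule exp_bregman_lower) auto
  finally show ?thesis .
qed

lemma exp_lipschitz:
  fixes s t B :: real
  assumes "\<bar>s\<bar> \<le> B" "\<bar>t\<bar> \<le> B"
  shows "\<bar>exp s - exp t\<bar> \<le> exp B * \<bar>s - t\<bar>"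
proof -
  have *: "exp s - exp t \<le> exp B * \<bar>s - t\<bar>" if "\<bar>s\<bar> \<le> B" for s t :: real
  proof -
    have "exp s - exp t \<le> exp s * (s - t)" using exp_bregman_nonneg[of t s] by (simp add: algebra_simps)
    also have "\<dots> \<le> exp s * \<bar>s - t\<bar>" by (intro mult_left_mono) auto
    also have "\<dots> \<le> exp B * \<bar>s - t\<bar>" using that by (intro mult_right_mono) auto
    finally show ?thesis .
  qed
  show ?thesis using *[OF assms(1), of t] *[OF assms(2), of s] by (simp add: abs_minus_commute)
qed

text \<open>For negative \<open>z\<close> the term \<open>- x * z\<close> already equals the left
  side. For \<open>z \<ge> 0\<close> the quadratic Taylor bound on \<open>exp\<close> absorbs
  \<open>2 * x * z\<close> after completing the square.\<close>

lemma exp_coercive: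
  fixes \<mu> x z :: real
  assumes "0 < \<mu>" "0 < x"
  shows "x * \<bar>z\<bar> \<le> \<mu> * exp z - x * z + 2 * x\<^sup>2 / \<mu>"
proof (cases "z \<ge> 0")
  case True
  have "1 + z + z\<^sup>2 / 2 \<le> exp z" using exp_lower_Taylor_quadratic[OF True] .
  then have "\<mu> * (z\<^sup>2 / 2) \<le> \<mu> * exp z" using True assms by (intro mult_left_mono) auto
  moreover have "0 \<le> \<mu> / 2 * (z - 2 * x / \<mu>)\<^sup>2" using assms by auto
  moreover have "\<mu> / 2 * (z - 2 * x / \<mu>)\<^sup>2 = \<mu> * (z\<^sup>2 / 2) + 2 * x\<^sup>2 / \<mu> - 2 * x * z"
    using assms by (simp add: power2_eq_square field_simps)
  ultimately show ?thesis using True by simp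
next
  case False
  then show ?thesis using assms by simp
qed

lemma sum_abs_power2_le:
  fixes f :: "'p \<Rightarrow> real"
  shows "(\<Sum>p\<in>P. \<bar>f p\<bar>)\<^sup>2 \<le> real (card P) * (\<Sum>p\<in>P. (f p)\<^sup>2)"
  using Cauchy_Schwarz_ineq_sum[of "\<lambda>_. 1" "\<lambda>p. \<bar>f p\<bar>" P] by simp

lemma finite_positive_lower_bound:
  fixes f :: "'p \<Rightarrow> real"
  assumes "finite P" "\<And>p. p \<in> P \<Longrightarrow> 0 < f p"
  obtains r where "0 < r" "\<And>p. p \<in> P \<Longrightarrow> r \<le> f p"
proof
  show "0 < Min (insert 1 (f ` P))" using assms by auto
  show "\<And>p. p \<in> P \<Longrightarrow> Min (insert 1 (f ` P)) \<le> f p" using assms by auto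
qed

text \<open>Telescoping bounds the distance from \<open>u l\<close> to every later term by the tail
  of a geometric series; letting the later index tend to infinity gives the rate.\<close>

lemma geometric_steps_converge:
  fixes u :: "nat \<Rightarrow> real"
  assumes step: "\<And>l. \<bar>u (Suc l) - u l\<bar> \<le> c * r ^ l" and r: "0 \<le> r" "r < 1"
  obtains L where "u \<longlonglongrightarrow> L" "\<And>l. \<bar>u l - L\<bar> \<le> c / (1 - r) * r ^ l"
proof -
  have c: "0 \<le> c" using step[of 0] by simp
  have dist: "\<bar>u (l + k) - u l\<bar> \<le> c / (1 - r) * r ^ l" for l k
  proof -
    have "\<bar>u (l + k) - u l\<bar> \<le> c * r ^ l * (\<Sum>j<k. r ^ j)"
    proof (induction k)
      case (Suc k)
      have "\<bar>u (l + Suc k) - u l\<bar> \<le> \<bar>u (Suc (l + k)) - u (l + k)\<bar> + \<bar>u (l + k) - u l\<bar>" by simp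
      also have "\<dots> \<le> c * r ^ (l + k) + c * r ^ l * (\<Sum>j<k. r ^ j)"
        using step[of "l + k"] Suc by linarith
      finally show ?case by (simp add: algebra_simps power_add)
    qed auto
    also have "\<dots> = c * r ^ l * ((1 - r ^ k) / (1 - r))" using r by (simp add: sum_gp_strict)
    also have "\<dots> \<le> c * r ^ l * (1 / (1 - r))"
      using r c by (intro mult_left_mono divide_right_mono) auto
    finally show ?thesis by simp
  qed
  have lim0: "(\<lambda>l. c / (1 - r) * r ^ l) \<longlonglongrightarrow> c / (1 - r) * 0"
    using r by (intro tendsto_intros LIMSEQ_realpow_zero)
  have "Cauchy u"
  proof (rule metric_CauchyI)
    fix e :: real assume e: "0 < e"
    then have "\<forall>\<^sub>F l in sequentially. c / (1 - r) * r ^ l < e / 2"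
      using order_tendstoD(2)[OF lim0, of "e / 2"] by simp
    then obtain M where M: "c / (1 - r) * r ^ M < e / 2" by (auto simp: eventually_sequentially)
    have "dist (u m) (u M) < e / 2" if "m \<ge> M" for m
      using le_less_trans[OF dist[of M "m - M"] M] that by (simp add: dist_real_def)
    then show "\<exists>M. \<forall>m\<ge>M. \<forall>n\<ge>M. dist (u m) (u n) < e"
      by (meson dist_triangle_half_l dist_commute)
  qed
  then obtain L where L: "u \<longlonglongrightarrow> L" using Cauchy_convergent convergent_def by blast
  show thesis
  proof (rule that[OF L])
    fix l
    have "(\<lambda>k. \<bar>u (k + l) - u l\<bar>) \<longlonglongrightarrow> \<bar>L - u l\<bar>"
      by (intro tendsto_intros LIMSEQ_ignore_initial_segment L)
    then have "\<bar>L - u l\<bar> \<le> c / (1 - r) * r ^ l"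
      using dist[of l] by (intro LIMSEQ_le_const2) (auto simp: add.commute)
    then show "\<bar>u l - L\<bar> \<le> c / (1 - r) * r ^ l" by (simp add: abs_minus_commute)
  qed
qed

text \<open>\<open>P\<close> indexes the dual variables and \<open>'k\<close> the primal entries.
  Variables outside \<open>Q\<close> are free multipliers of primal equations, those in
  \<open>Q\<close> are nonpositive multipliers of primal inequalities. \<open>xh\<close> is a
  strictly positive primal feasible point.\<close>

locale exp_program =
  fixes P Q :: "'p set" and a :: "'p \<Rightarrow> 'k::finite \<Rightarrow> real" and \<beta> :: "'p \<Rightarrow> real"
    and \<mu> xh :: "'k \<Rightarrow> real"
  assumes finP: "finite P" and QP: "Q \<subseteq> P"
    and \<mu>: "\<And>k. 0 < \<mu> k" and xh: "\<And>k. 0 < xh k"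
    and xh_eq: "\<And>p. p \<in> P \<Longrightarrow> p \<notin> Q \<Longrightarrow> (\<Sum>k\<in>UNIV. a p k * xh k) = \<beta> p"
    and xh_le: "\<And>p. p \<in> Q \<Longrightarrow> (\<Sum>k\<in>UNIV. a p k * xh k) \<le> \<beta> p"
begin

section \<open>The objective, its first-order expansion and its coercivity\<close>

definition z :: "('p \<Rightarrow> real) \<Rightarrow> 'k \<Rightarrow> real"
  where "z x k = (\<Sum>p\<in>P. x p * a p k)"

definition F :: "('p \<Rightarrow> real) \<Rightarrow> real"
  where "F x = (\<Sum>k\<in>UNIV. \<mu> k * exp (z x k)) - (\<Sum>p\<in>P. x p * \<beta> p)"

text \<open>The partial derivatives of \<open>F\<close>. They are also the residuals of the primal
  constraints at the point with entries \<open>\<mu> k * exp (z x k)\<close>, which links dual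
  optimality to primal feasibility.\<close>

definition G :: "('p \<Rightarrow> real) \<Rightarrow> 'p \<Rightarrow> real"
  where "G x p = (\<Sum>k\<in>UNIV. a p k * (\<mu> k * exp (z x k))) - \<beta> p"

definition feasible :: "('p \<Rightarrow> real) \<Rightarrow> bool"
  where "feasible x \<longleftrightarrow> (\<forall>p\<in>Q. x p \<le> 0)"

lemma z_cong: "(\<And>p. p \<in> P \<Longrightarrow> x p = y p) \<Longrightarrow> z x = z y"
  unfolding z_def by (auto intro!: ext sum.cong)

lemma F_cong: "(\<And>p. p \<in> P \<Longrightarrow> x p = y p) \<Longrightarrow> F x = F y"
  unfolding F_def using z_cong[of x y] by (auto intro!: sum.cong)

text \<open>Serves to exclude zero columns later: a variable with zero column and zero right-hand
  side could be changed freely, against uniqueness of the block minimizers.\<close>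

lemma F_cong_zero_columns:
  assumes "\<And>p. p \<in> P \<Longrightarrow> x p = y p \<or> (\<forall>k. a p k = 0) \<and> \<beta> p = 0"
  shows "F x = F y"
proof -
  have "z x = z y" unfolding z_def using assms by (fastforce intro!: ext sum.cong)
  moreover have "(\<Sum>p\<in>P. x p * \<beta> p) = (\<Sum>p\<in>P. y p * \<beta> p)"
    using assms by (fastforce intro!: sum.cong)
  ultimately show ?thesis unfolding F_def by simp
qed

lemma z_diff: "z v k - z x k = (\<Sum>p\<in>P. (v p - x p) * a p k)"
  unfolding z_def by (simp add: sum_subtractf algebra_simps)

lemma abs_z_diff: "\<bar>z v k - z x k\<bar> \<le> (\<Sum>p\<in>P. \<bar>v p - x p\<bar> * \<bar>a p k\<bar>)"
  unfolding z_diff by (rule order_trans[OF sum_abs]) (simp add: abs_mult)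

text \<open>The adjoint identity for the linear map \<open>z\<close>, applied to a
  difference.\<close>

lemma z_swap: "(\<Sum>k\<in>UNIV. h k * (z v k - z x k)) = (\<Sum>p\<in>P. (\<Sum>k\<in>UNIV. a p k * h k) * (v p - x p))"
proof -
  have "(\<Sum>k\<in>UNIV. h k * (z v k - z x k)) = (\<Sum>k\<in>UNIV. \<Sum>p\<in>P. a p k * h k * (v p - x p))"
    unfolding z_diff by (simp add: sum_distrib_left ac_simps)
  also have "\<dots> = (\<Sum>p\<in>P. \<Sum>k\<in>UNIV. a p k * h k * (v p - x p))" by (rule sum.swap)
  finally show ?thesis by (simp add: sum_distrib_right)
qed

text \<open>The linear part of \<open>F\<close> cancels, so the remainder after the first-order term
  is a weighted sum of Bregman distances of \<open>exp\<close>. Convexity, quadratic growth and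
  sufficient decrease are all read off from this identity.\<close>

lemma F_expand:
  "F v - F x = (\<Sum>k\<in>UNIV. \<mu> k * (exp (z v k) - exp (z x k) - exp (z x k) * (z v k - z x k)))
     + (\<Sum>p\<in>P. G x p * (v p - x p))"
proof -
  have "(\<Sum>k\<in>UNIV. \<mu> k * exp (z x k) * (z v k - z x k))
      = (\<Sum>p\<in>P. (\<Sum>k\<in>UNIV. a p k * (\<mu> k * exp (z x k))) * (v p - x p))"
    by (rule z_swap)
  then show ?thesis unfolding F_def G_def
    by (simp add: algebra_simps sum_subtractf sum.distrib)
qed

lemma F_ge_linear: "(\<Sum>p\<in>P. G x p * (v p - x p)) \<le> F v - F x"
  unfolding F_expand using less_imp_le[OF \<mu>] exp_bregman_nonneg
  by (simp add: sum_nonneg)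

definition slack :: "'p \<Rightarrow> real"
  where "slack p = \<beta> p - (\<Sum>k\<in>UNIV. a p k * xh k)"

lemma slack: "p \<in> P \<Longrightarrow> 0 \<le> slack p" "p \<in> P \<Longrightarrow> p \<notin> Q \<Longrightarrow> slack p = 0"
  unfolding slack_def using xh_eq[of p] xh_le[of p] by (cases "p \<in> Q"; simp)+

text \<open>Pairing with the interior point \<open>xh\<close> turns the linear part into one that is nonnegative on the
  feasible set.\<close>

lemma F_slack: "F x = (\<Sum>k\<in>UNIV. \<mu> k * exp (z x k) - xh k * z x k) - (\<Sum>p\<in>P. slack p * x p)"
proof -
  have "(\<Sum>k\<in>UNIV. xh k * z x k) = (\<Sum>p\<in>P. (\<Sum>k\<in>UNIV. a p k * xh k) * x p)"
    using z_swap[of xh x "\<lambda>_. 0"] by (simp add: z_def)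
  then show ?thesis unfolding F_def slack_def by (simp add: algebra_simps sum_subtractf)
qed

text \<open>The exponential terms are handled one by one by \<open>exp_coercive\<close>. The slack
  terms have the right sign, since the slack vanishes off \<open>Q\<close> and feasible points are
  nonpositive on \<open>Q\<close>.\<close>

lemma F_coercive:
  assumes "feasible x"
  shows "(\<Sum>k\<in>UNIV. xh k * \<bar>z x k\<bar>) + (\<Sum>p\<in>P. slack p * \<bar>x p\<bar>)
    \<le> F x + (\<Sum>k\<in>UNIV. 2 * (xh k)\<^sup>2 / \<mu> k)"
proof -
  have "(\<Sum>k\<in>UNIV. xh k * \<bar>z x k\<bar>) \<le> (\<Sum>k\<in>UNIV. \<mu> k * exp (z x k) - xh k * z x k + 2 * (xh k)\<^sup>2 / \<mu> k)"
    by (intro sum_mono exp_coercive \<mu> xh)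
  moreover have "(\<Sum>p\<in>P. slack p * \<bar>x p\<bar>) = (\<Sum>p\<in>P. - (slack p * x p))"
  proof (rule sum.cong)
    fix p assume "p \<in> P"
    then show "slack p * \<bar>x p\<bar> = - (slack p * x p)"
      using assms slack[of p] unfolding feasible_def by (cases "p \<in> Q") auto
  qed auto
  ultimately show ?thesis unfolding F_slack by (simp add: sum.distrib sum_negf)
qed

text \<open>Every summand on the left of \<open>F_coercive\<close> is nonnegative, hence bounded by
  the whole right side. Only \<open>z\<close> and the coordinates with nonzero slack are controlled;
  directions in the kernel of \<open>z\<close> may leave the others unbounded.\<close>

lemma sublevel_bounded:
  obtains B where "0 < B" "\<And>x k. feasible x \<Longrightarrow> F x \<le> \<alpha> \<Longrightarrow> \<bar>z x k\<bar> \<le> B"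
    "\<And>x p. feasible x \<Longrightarrow> F x \<le> \<alpha> \<Longrightarrow> p \<in> P \<Longrightarrow> slack p \<noteq> 0 \<Longrightarrow> \<bar>x p\<bar> \<le> B"
proof -
  define D where "D = \<bar>\<alpha> + (\<Sum>k\<in>UNIV. 2 * (xh k)\<^sup>2 / \<mu> k)\<bar>"
  obtain r where r: "0 < r" "\<And>k. r \<le> xh k" using finite_positive_lower_bound[of UNIV xh] xh by (metis finite_class.finite_UNIV UNIV_I)
  obtain r' where r': "0 < r'" "\<And>p. p \<in> {p\<in>P. slack p \<noteq> 0} \<Longrightarrow> r' \<le> slack p"
  proof (rule finite_positive_lower_bound[of "{p\<in>P. slack p \<noteq> 0}" slack])
    show "finite {p\<in>P. slack p \<noteq> 0}" using finP by simp
    show "0 < slack p" if "p \<in> {p\<in>P. slack p \<noteq> 0}" for p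
      using that slack(1)[of p] by (simp add: order_le_less)
  qed blast
  have D: "(\<Sum>k\<in>UNIV. xh k * \<bar>z x k\<bar>) + (\<Sum>p\<in>P. slack p * \<bar>x p\<bar>) \<le> D" if "feasible x" "F x \<le> \<alpha>" for x
    using F_coercive[OF that(1)] that(2) unfolding D_def by linarith
  have nn: "0 \<le> (\<Sum>k\<in>UNIV. xh k * \<bar>z x k\<bar>)" "0 \<le> (\<Sum>p\<in>P. slack p * \<bar>x p\<bar>)" for x
    using less_imp_le[OF xh] slack(1) by (simp_all add: sum_nonneg)
  show thesis
  proof
    have "0 \<le> D" unfolding D_def by simp
    then show "0 < D / r + D / r' + 1" using r(1) r'(1) by (simp add: add_nonneg_pos)
    fix x k assume x: "feasible x" "F x \<le> \<alpha>"
    have "r * \<bar>z x k\<bar> \<le> xh k * \<bar>z x k\<bar>" using r by (intro mult_right_mono) auto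
    also have "\<dots> \<le> (\<Sum>k\<in>UNIV. xh k * \<bar>z x k\<bar>)"
      using less_imp_le[OF xh] by (intro member_le_sum) simp_all
    also have "\<dots> \<le> D" using D[OF x] nn(2)[of x] by linarith
    finally have "\<bar>z x k\<bar> \<le> D / r" using r by (simp add: field_simps)
    then show "\<bar>z x k\<bar> \<le> D / r + D / r' + 1" using divide_nonneg_pos[OF \<open>0 \<le> D\<close> r'(1)] by linarith
  next
    have "0 \<le> D" unfolding D_def by simp
    fix x p assume x: "feasible x" "F x \<le> \<alpha>" and p: "p \<in> P" "slack p \<noteq> 0"
    have "r' * \<bar>x p\<bar> \<le> slack p * \<bar>x p\<bar>" using r' p by (intro mult_right_mono) auto
    also have "\<dots> \<le> (\<Sum>p\<in>P. slack p * \<bar>x p\<bar>)"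
      using slack(1) p(1) finP by (intro member_le_sum) simp_all
    also have "\<dots> \<le> D" using D[OF x] nn(1)[of x] by linarith
    finally have "\<bar>x p\<bar> \<le> D / r'" using r' by (simp add: field_simps)
    then show "\<bar>x p\<bar> \<le> D / r + D / r' + 1" using divide_nonneg_pos[OF \<open>0 \<le> D\<close> r(1)] by linarith
  qed
qed

section \<open>First-order optimality conditions\<close>

lemma variational_inequality:
  assumes "\<And>t. 0 \<le> t \<Longrightarrow> t \<le> 1 \<Longrightarrow> F w \<le> F (\<lambda>p. w p + t * (v p - w p))"
  shows "0 \<le> (\<Sum>p\<in>P. G w p * (v p - w p))"
proof (rule ccontr)
  define S where "S = (\<Sum>p\<in>P. G w p * (v p - w p))"
  define f where "f t = F (\<lambda>p. w p + t * (v p - w p))" for t :: real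
  assume "\<not> ?thesis"
  then have S: "S < 0" unfolding S_def by simp
  have ft: "f t = (\<Sum>k\<in>UNIV. \<mu> k * exp (z w k + t * (z v k - z w k))) - (\<Sum>p\<in>P. (w p + t * (v p - w p)) * \<beta> p)" for t
  proof -
    have "z (\<lambda>p. w p + t * (v p - w p)) k = z w k + t * (z v k - z w k)" for k
      unfolding z_diff unfolding z_def by (simp add: sum.distrib sum_subtractf sum_distrib_left algebra_simps)
    then show ?thesis unfolding f_def F_def by simp
  qed
  have "((\<lambda>t. (\<Sum>k\<in>UNIV. \<mu> k * exp (z w k + t * (z v k - z w k))) - (\<Sum>p\<in>P. (w p + t * (v p - w p)) * \<beta> p))
      has_real_derivative (\<Sum>k\<in>UNIV. \<mu> k * (exp (z w k) * (z v k - z w k))) - (\<Sum>p\<in>P. (v p - w p) * \<beta> p)) (at 0)"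
    by (auto intro!: derivative_eq_intros sum.cong)
  moreover have "(\<Sum>k\<in>UNIV. \<mu> k * (exp (z w k) * (z v k - z w k))) - (\<Sum>p\<in>P. (v p - w p) * \<beta> p) = S"
    unfolding S_def G_def using z_swap[of "\<lambda>k. \<mu> k * exp (z w k)" v w]
    by (simp add: algebra_simps sum_subtractf sum.distrib)
  ultimately have "(f has_real_derivative S) (at 0)" unfolding ft[abs_def] by simp
  \<comment> \<open>A negative directional derivative makes \<open>F\<close> smaller after a short
    step towards \<open>v\<close>, contrary to the assumption.\<close>
  from DERIV_neg_dec_right[OF this S] obtain d where d: "d > 0" "\<And>h. h > 0 \<Longrightarrow> h < d \<Longrightarrow> f (0 + h) < f 0"
    by auto
  define h where "h = min (d / 2) 1"
  have h: "h > 0" "h < d" "h \<le> 1" unfolding h_def using d(1) by auto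
  then have "f h < f 0" using d(2)[of h] by simp
  moreover have "f 0 \<le> f h" using assms[of h] h unfolding f_def by simp
  ultimately show False by simp
qed

lemma block_minimizer_variational_inequality:
  assumes "feasible w" "feasible v" "\<And>p. p \<in> P - J \<Longrightarrow> v p = w p"
    and "\<And>u. feasible u \<Longrightarrow> (\<And>p. p \<in> P - J \<Longrightarrow> u p = w p) \<Longrightarrow> F w \<le> F u"
  shows "0 \<le> (\<Sum>p\<in>P. G w p * (v p - w p))"
proof (rule variational_inequality)
  fix t :: real assume t: "0 \<le> t" "t \<le> 1"
  have "feasible (\<lambda>p. w p + t * (v p - w p))"
    unfolding feasible_def
  proof
    fix p assume "p \<in> Q"
    then have "w p \<le> 0" "v p \<le> 0" using assms unfolding feasible_def by auto
    then have "(1 - t) * w p + t * v p \<le> 0"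
      using t by (intro add_nonpos_nonpos mult_nonneg_nonpos) auto
    then show "w p + t * (v p - w p) \<le> 0" by (simp add: algebra_simps)
  qed
  then show "F w \<le> F (\<lambda>p. w p + t * (v p - w p))" using assms(3) by (intro assms(4)) auto
qed

text \<open>The sign constraints are separable, so a single coordinate can be varied within its
  block. This coordinatewise form allows conditions from different intermediate points of a sweep to
  be summed.\<close>

lemma block_minimizer_coordinate:
  assumes "feasible w" "p \<in> P" "p \<in> J" "p \<in> Q \<Longrightarrow> c \<le> 0"
    and "\<And>u. feasible u \<Longrightarrow> (\<And>p. p \<in> P - J \<Longrightarrow> u p = w p) \<Longrightarrow> F w \<le> F u"
  shows "0 \<le> G w p * (c - w p)"
proof -
  have "0 \<le> (\<Sum>q\<in>P. G w q * ((w(p := c)) q - w q))"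
    using assms by (intro block_minimizer_variational_inequality[of w _ J]) (auto simp: feasible_def)
  also have "\<dots> = (\<Sum>q\<in>P. if q = p then G w p * (c - w p) else 0)"
    by (rule sum.cong) auto
  finally show ?thesis using finP assms(2) by simp
qed

text \<open>Testing the coordinate inequality with \<open>w p - 1\<close>, with
  \<open>w p + 1\<close> for free coordinates, and with \<open>0\<close> for constrained ones yields
  the three conditions in turn.\<close>

lemma minimizer_kkt:
  assumes "feasible w" "\<And>u. feasible u \<Longrightarrow> F w \<le> F u" "p \<in> P"
  shows "p \<notin> Q \<Longrightarrow> G w p = 0" "p \<in> Q \<Longrightarrow> G w p \<le> 0" "G w p * w p = 0"
proof -
  have *: "0 \<le> G w p * (c - w p)" if "p \<in> Q \<Longrightarrow> c \<le> 0" for c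
    using assms that by (intro block_minimizer_coordinate[of w p P]) auto
  have le: "G w p \<le> 0" using *[of "w p - 1"] assms(1) unfolding feasible_def by force
  show 1: "G w p = 0" if "p \<notin> Q" using *[of "w p + 1"] le that by auto
  show "G w p \<le> 0" using le .
  show "G w p * w p = 0"
  proof (cases "p \<in> Q")
    case True
    then have "w p \<le> 0" using assms(1) unfolding feasible_def by auto
    then have "0 \<le> G w p * w p" using le by (simp add: mult_nonpos_nonpos)
    moreover have "0 \<le> G w p * (0 - w p)" by (rule *) auto
    ultimately show ?thesis by simp
  qed (use 1 in auto)
qed

text \<open>The first-order condition at the primal candidate \<open>\<mu> k * exp (z w k)\<close>.
  The adjoint identity turns the sum into residuals paired with multipliers: terms of equations
  vanish, and those of inequalities are nonnegative by sign and complementary slackness.\<close>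

lemma minimizer_primal_gap:
  assumes w: "feasible w" "\<And>u. feasible u \<Longrightarrow> F w \<le> F u"
    and eq: "\<And>p. p \<in> P \<Longrightarrow> p \<notin> Q \<Longrightarrow> (\<Sum>k\<in>UNIV. a p k * Z k) = \<beta> p"
    and le: "\<And>p. p \<in> Q \<Longrightarrow> (\<Sum>k\<in>UNIV. a p k * Z k) \<le> \<beta> p"
  shows "0 \<le> (\<Sum>k\<in>UNIV. z w k * (Z k - \<mu> k * exp (z w k)))"
proof -
  have "(\<Sum>k\<in>UNIV. z w k * (Z k - \<mu> k * exp (z w k)))
      = (\<Sum>p\<in>P. (\<Sum>k\<in>UNIV. a p k * (Z k - \<mu> k * exp (z w k))) * w p)"
    using z_swap[of "\<lambda>k. Z k - \<mu> k * exp (z w k)" w "\<lambda>_. 0"] by (simp add: z_def mult.commute)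
  also have "0 \<le> \<dots>"
  proof (rule sum_nonneg)
    fix p assume p: "p \<in> P"
    have s: "(\<Sum>k\<in>UNIV. a p k * (Z k - \<mu> k * exp (z w k))) = (\<Sum>k\<in>UNIV. a p k * Z k) - \<beta> p - G w p"
      unfolding G_def by (simp add: right_diff_distrib sum_subtractf)
    show "0 \<le> (\<Sum>k\<in>UNIV. a p k * (Z k - \<mu> k * exp (z w k))) * w p"
    proof (cases "p \<in> Q")
      case True
      then have "w p \<le> 0" using w(1) unfolding feasible_def by auto
      then have "0 \<le> ((\<Sum>k\<in>UNIV. a p k * Z k) - \<beta> p) * w p"
        using le[OF True] by (intro mult_nonpos_nonpos) auto
      then show ?thesis using minimizer_kkt(3)[OF w p] unfolding s by (simp only: left_diff_distrib)
    next
      case False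
      then show ?thesis using minimizer_kkt(1)[OF w p] eq[OF p] unfolding s by simp
    qed
  qed
  finally show ?thesis .
qed

section \<open>Error bounds, existence of minimizers and quadratic growth\<close>

lemma hoffman_faces:
  assumes "I \<subseteq> P"
  shows "\<exists>H\<ge>0. \<forall>x x0. feasible x \<longrightarrow> feasible x0 \<longrightarrow>
    (\<exists>y. feasible y \<and> (\<forall>k. z y k = z x0 k) \<and> (\<forall>p\<in>I. y p = x0 p) \<and>
       (\<forall>p\<in>P. \<bar>x p - y p\<bar> \<le> H * ((\<Sum>k\<in>UNIV. \<bar>z x k - z x0 k\<bar>) + (\<Sum>p\<in>I. \<bar>x p - x0 p\<bar>))))"
proof -
  define e :: "'p \<Rightarrow> 'p \<Rightarrow> real" where "e q p = (if p = q then 1 else 0)" for p q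
  \<comment> \<open>These rows describe the feasible points that share \<open>z\<close> and the
    coordinates in \<open>I\<close> with \<open>x0\<close>, each equation being written as two
    inequalities. The point \<open>x0\<close> is the parameter of the right-hand sides, so one
    constant serves all \<open>x0\<close>.\<close>
  define R :: "(('p \<Rightarrow> real) \<times> (('p \<Rightarrow> real) \<Rightarrow> real)) set"
    where "R = (\<lambda>k. ((\<lambda>p. a p k), (\<lambda>x0. z x0 k))) ` UNIV \<union> (\<lambda>k. ((\<lambda>p. - a p k), (\<lambda>x0. - z x0 k))) ` UNIV
      \<union> (\<lambda>q. (e q, (\<lambda>x0. x0 q))) ` I \<union> (\<lambda>q. ((\<lambda>p. - e q p), (\<lambda>x0. - x0 q))) ` I
      \<union> (\<lambda>q. (e q, (\<lambda>x0. 0))) ` Q"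
  have "finite I" "finite Q" using finite_subset[OF assms finP] finite_subset[OF QP finP] .
  then have "finite R" unfolding R_def by auto
  have e: "(\<Sum>p\<in>P. e q p * x p) = x q" if "q \<in> P" for q x
  proof -
    have "(\<Sum>p\<in>P. e q p * x p) = (\<Sum>p\<in>P. if p = q then x q else 0)"
      by (rule sum.cong) (auto simp: e_def)
    then show ?thesis using finP that by simp
  qed
  have za: "(\<Sum>p\<in>P. a p k * x p) = z x k" for k x unfolding z_def by (simp add: mult.commute)
  have all: "(\<forall>(\<alpha>, \<kappa>)\<in>R. (\<Sum>p\<in>P. \<alpha> p * x p) \<le> \<kappa> x0 + v) \<longleftrightarrow>
     (\<forall>k. z x k \<le> z x0 k + v) \<and> (\<forall>k. - z x k \<le> - z x0 k + v) \<and> (\<forall>q\<in>I. x q \<le> x0 q + v)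
     \<and> (\<forall>q\<in>I. - x q \<le> - x0 q + v) \<and> (\<forall>q\<in>Q. x q \<le> v)" for x x0 v
  proof -
    have I: "\<And>q x. q \<in> I \<Longrightarrow> (\<Sum>p\<in>P. e q p * x p) = x q" and Q: "\<And>q x. q \<in> Q \<Longrightarrow> (\<Sum>p\<in>P. e q p * x p) = x q"
      using assms QP e by auto
    show ?thesis unfolding R_def
      by (simp add: ball_Un sum_negf za I Q)
  qed
  obtain H where H: "H \<ge> 0"
    "\<And>c x v. 0 \<le> v \<Longrightarrow> (\<forall>(\<alpha>, \<kappa>)\<in>R. (\<Sum>p\<in>P. \<alpha> p * x p) \<le> \<kappa> c + v) \<Longrightarrow>
    (\<exists>y. \<forall>(\<alpha>, \<kappa>)\<in>R. (\<Sum>p\<in>P. \<alpha> p * y p) \<le> \<kappa> c) \<Longrightarrow>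
    (\<exists>y. (\<forall>(\<alpha>, \<kappa>)\<in>R. (\<Sum>p\<in>P. \<alpha> p * y p) \<le> \<kappa> c) \<and> (\<forall>p\<in>P. \<bar>x p - y p\<bar> \<le> H * v))"
    using hoffman[OF finP \<open>finite R\<close>] by blast
  show ?thesis
  proof (intro exI[of _ H] conjI allI impI H(1))
    fix x x0 assume x: "feasible x" and x0: "feasible x0"
    define v where "v = (\<Sum>k\<in>UNIV. \<bar>z x k - z x0 k\<bar>) + (\<Sum>p\<in>I. \<bar>x p - x0 p\<bar>)"
    have v0: "0 \<le> v" unfolding v_def by (intro add_nonneg_nonneg sum_nonneg) auto
    have v_parts: "0 \<le> (\<Sum>k\<in>UNIV. \<bar>z x k - z x0 k\<bar>)" "0 \<le> (\<Sum>p\<in>I. \<bar>x p - x0 p\<bar>)"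
      by (simp_all add: sum_nonneg)
    have vz: "\<bar>z x k - z x0 k\<bar> \<le> v" for k
    proof -
      have "\<bar>z x k - z x0 k\<bar> \<le> (\<Sum>k\<in>UNIV. \<bar>z x k - z x0 k\<bar>)" by (rule member_le_sum) auto
      then show ?thesis using v_parts unfolding v_def by linarith
    qed
    have vI: "\<bar>x p - x0 p\<bar> \<le> v" if "p \<in> I" for p
    proof -
      have "\<bar>x p - x0 p\<bar> \<le> (\<Sum>p\<in>I. \<bar>x p - x0 p\<bar>)"
        using that \<open>finite I\<close> by (intro member_le_sum) auto
      then show ?thesis using v_parts unfolding v_def by linarith
    qed
    have 1: "\<forall>(\<alpha>, \<kappa>)\<in>R. (\<Sum>p\<in>P. \<alpha> p * x p) \<le> \<kappa> x0 + v"
      unfolding all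
    proof (intro conjI allI ballI)
      show "z x k \<le> z x0 k + v" "- z x k \<le> - z x0 k + v" for k using vz[of k] by linarith+
      show "x q \<le> x0 q + v" "- x q \<le> - x0 q + v" if "q \<in> I" for q using vI[OF that] by linarith+
      show "x q \<le> v" if "q \<in> Q" for q using x v0 that unfolding feasible_def by force
    qed
    have 2: "\<exists>y. \<forall>(\<alpha>, \<kappa>)\<in>R. (\<Sum>p\<in>P. \<alpha> p * y p) \<le> \<kappa> x0"
      using all[of x0 x0 0] x0 unfolding feasible_def by (intro exI[of _ x0]) simp
    from H(2)[OF v0 1 2] obtain y where y: "\<forall>(\<alpha>, \<kappa>)\<in>R. (\<Sum>p\<in>P. \<alpha> p * y p) \<le> \<kappa> x0"
      "\<forall>p\<in>P. \<bar>x p - y p\<bar> \<le> H * v" by blast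
    show "\<exists>y. feasible y \<and> (\<forall>k. z y k = z x0 k) \<and> (\<forall>p\<in>I. y p = x0 p) \<and>
       (\<forall>p\<in>P. \<bar>x p - y p\<bar> \<le> H * ((\<Sum>k\<in>UNIV. \<bar>z x k - z x0 k\<bar>) + (\<Sum>p\<in>I. \<bar>x p - x0 p\<bar>)))"
      using y(1) all[of y x0 0] y(2) unfolding v_def[symmetric] feasible_def
      by (intro exI[of _ y]) (auto intro: antisym)
  qed
qed

lemma minimizer_exists:
  obtains x0 where "feasible x0" "\<And>x. feasible x \<Longrightarrow> F x0 \<le> F x"
proof -
  define I where "I = {p\<in>P. slack p \<noteq> 0}"
  have IP: "I \<subseteq> P" unfolding I_def by auto
  have fz: "feasible (\<lambda>_. 0)" unfolding feasible_def by simp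
  define \<alpha> where "\<alpha> = F (\<lambda>_. 0)"
  obtain B where B: "0 < B" "\<And>x k. feasible x \<Longrightarrow> F x \<le> \<alpha> \<Longrightarrow> \<bar>z x k\<bar> \<le> B"
    "\<And>x p. feasible x \<Longrightarrow> F x \<le> \<alpha> \<Longrightarrow> p \<in> P \<Longrightarrow> slack p \<noteq> 0 \<Longrightarrow> \<bar>x p\<bar> \<le> B"
    using sublevel_bounded[of \<alpha>] by blast
  obtain H where H: "H \<ge> 0" "\<And>x x0. feasible x \<Longrightarrow> feasible x0 \<Longrightarrow>
    (\<exists>y. feasible y \<and> (\<forall>k. z y k = z x0 k) \<and> (\<forall>p\<in>I. y p = x0 p) \<and>
       (\<forall>p\<in>P. \<bar>x p - y p\<bar> \<le> H * ((\<Sum>k\<in>UNIV. \<bar>z x k - z x0 k\<bar>) + (\<Sum>p\<in>I. \<bar>x p - x0 p\<bar>))))"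
    using hoffman_faces[OF IP] by blast
  define D where "D = H * (real CARD('k) * B + real (card I) * B)"
  have D0: "0 \<le> D" unfolding D_def using H(1) B(1) by auto
  \<comment> \<open>\<open>D\<close> is the Hoffman bound for data of size \<open>B\<close>.
    Coordinates outside \<open>P\<close> are pinned to 0, so that the box is compact in the product
    topology.\<close>
  define K :: "('p \<Rightarrow> real) set" where "K = PiE UNIV (\<lambda>p. if p \<in> P then (if p \<in> Q then {-D..0} else {-D..D}) else {0})"
  have "compactin (product_topology (\<lambda>i. euclidean) UNIV) K"
    unfolding K_def by (subst compactin_PiE) (auto simp: compactin_euclidean_iff)
  then have "compact K" by (simp add: euclidean_product_topology)
  moreover have "(\<lambda>_. 0) \<in> K" unfolding K_def using D0 by auto
  moreover have "continuous_on K F"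
    unfolding F_def[abs_def] z_def
    by (intro continuous_intros continuous_on_subset[OF continuous_on_product_coordinates]) auto
  ultimately obtain x0 where x0: "x0 \<in> K" "\<And>x. x \<in> K \<Longrightarrow> F x0 \<le> F x"
    using continuous_attains_inf[of K F] by blast
  have x0f: "feasible x0" unfolding feasible_def
  proof
    fix p assume p: "p \<in> Q"
    have "x0 p \<in> (if p \<in> P then (if p \<in> Q then {-D..0} else {-D..D}) else {0})"
      using x0(1) unfolding K_def by (rule PiE_mem) simp
    then show "x0 p \<le> 0" using p QP by (auto split: if_splits)
  qed
  show thesis
  proof
    show "feasible x0" by fact
    fix x assume x: "feasible x"
    show "F x0 \<le> F x"
    proof (cases "F x \<le> \<alpha>")
      case False
      then show ?thesis using x0(2)[OF \<open>(\<lambda>_. 0) \<in> K\<close>] unfolding \<alpha>_def by simp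
    next
      case True
      from H(2)[OF fz x] obtain y where y: "feasible y" "\<And>k. z y k = z x k" "\<And>p. p \<in> I \<Longrightarrow> y p = x p"
        "\<And>p. p \<in> P \<Longrightarrow> \<bar>0 - y p\<bar> \<le> H * ((\<Sum>k\<in>UNIV. \<bar>z (\<lambda>_. 0) k - z x k\<bar>) + (\<Sum>p\<in>I. \<bar>0 - x p\<bar>))"
        by blast
      \<comment> \<open>\<open>F\<close> only sees \<open>z\<close> and the coordinates with nonzero slack, all bounded on the sublevel set;
        Hoffman's bound at \<open>0\<close> replaces \<open>x\<close> by a point of a fixed box with the same data.\<close>
      have "(\<Sum>p\<in>P. slack p * y p) = (\<Sum>p\<in>P. slack p * x p)"
        by (rule sum.cong) (use y(3) I_def in auto)
      then have Fy: "F y = F x" unfolding F_slack y(2) by simp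
      have "(\<Sum>k\<in>UNIV. \<bar>z (\<lambda>_. 0) k - z x k\<bar>) \<le> (\<Sum>k\<in>(UNIV::'k set). B)"
        using B(2)[OF x True] by (intro sum_mono) (simp add: z_def)
      moreover have "(\<Sum>p\<in>I. \<bar>0 - x p\<bar>) \<le> (\<Sum>p\<in>I. B)"
        using B(3)[OF x True] by (intro sum_mono) (simp add: I_def)
      ultimately have "H * ((\<Sum>k\<in>UNIV. \<bar>z (\<lambda>_. 0) k - z x k\<bar>) + (\<Sum>p\<in>I. \<bar>0 - x p\<bar>)) \<le> D"
        unfolding D_def using H(1) by (intro mult_left_mono) auto
      then have yD: "- D \<le> y p" "y p \<le> D" if "p \<in> P" for p using y(4)[OF that] by linarith+
      have "F x0 \<le> F (\<lambda>p. if p \<in> P then y p else 0)"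
      proof (rule x0(2))
        show "(\<lambda>p. if p \<in> P then y p else 0) \<in> K"
          unfolding K_def using yD y(1) QP by (auto simp: feasible_def)
      qed
      also have "\<dots> = F y" by (rule F_cong) auto
      finally show ?thesis using Fy by simp
    qed
  qed
qed

text \<open>In the expansion at \<open>x0\<close>, complementarity reduces the first-order term to a
  nonnegative sum over the coordinates \<open>I\<close> with nonzero gradient. The gap therefore
  controls \<open>z\<close> quadratically and these coordinates linearly. Points that agree with
  \<open>x0\<close> in \<open>z\<close> and on \<open>I\<close> have minimal value, and
  \<open>hoffman_faces\<close> bounds the distance to such a point.\<close>

lemma quadratic_growth:
  assumes x0: "feasible x0" "\<And>x. feasible x \<Longrightarrow> F x0 \<le> F x"
  obtains C where "0 \<le> C" "\<And>x. feasible x \<Longrightarrow> F x \<le> \<alpha> \<Longrightarrow>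
    \<exists>y. feasible y \<and> F y = F x0 \<and> (\<Sum>p\<in>P. \<bar>x p - y p\<bar>)\<^sup>2 \<le> C * (F x - F x0)"
proof -
  define I where "I = {p\<in>P. G x0 p \<noteq> 0}"
  have IP: "I \<subseteq> P" unfolding I_def by auto
  then have finI: "finite I" using finP by (rule finite_subset)
  have IQ: "I \<subseteq> Q" using minimizer_kkt(1)[OF x0] unfolding I_def by blast
  have xI: "x0 p = 0" if "p \<in> I" for p using minimizer_kkt(3)[OF x0, of p] that unfolding I_def by simp
  have GI: "G x0 p < 0" if "p \<in> I" for p 
    using minimizer_kkt(2)[OF x0, of p] that IQ IP unfolding I_def by (simp add: subset_iff order_le_less)
  obtain B where B: "0 < B" "\<And>x k. feasible x \<Longrightarrow> F x \<le> max \<alpha> (F x0) \<Longrightarrow> \<bar>z x k\<bar> \<le> B"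
    by (rule sublevel_bounded[of "max \<alpha> (F x0)"]) (rule that)
  obtain H where H: "H \<ge> 0" "\<And>x x0. feasible x \<Longrightarrow> feasible x0 \<Longrightarrow>
    (\<exists>y. feasible y \<and> (\<forall>k. z y k = z x0 k) \<and> (\<forall>p\<in>I. y p = x0 p) \<and>
       (\<forall>p\<in>P. \<bar>x p - y p\<bar> \<le> H * ((\<Sum>k\<in>UNIV. \<bar>z x k - z x0 k\<bar>) + (\<Sum>p\<in>I. \<bar>x p - x0 p\<bar>))))"
    using hoffman_faces[OF IP] by blast
  obtain m where m: "0 < m" "\<And>k. m \<le> \<mu> k" using finite_positive_lower_bound[of UNIV \<mu>] \<mu> by (metis finite_class.finite_UNIV UNIV_I)
  obtain g where g: "0 < g" "\<And>p. p \<in> I \<Longrightarrow> g \<le> - G x0 p"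
  proof (rule finite_positive_lower_bound[OF finI, of "\<lambda>p. - G x0 p"])
    show "0 < - G x0 p" if "p \<in> I" for p using GI[OF that] by simp
  qed blast
  define \<sigma> where "\<sigma> = m * (exp (- (3 * B)) / 2)"
  have \<sigma>: "0 < \<sigma>" unfolding \<sigma>_def using m by simp
  \<comment> \<open>\<open>E\<close> bounds the gap on the sublevel set; replacing one factor of the
    squared gap by \<open>E\<close> turns the linear control on \<open>I\<close> into a quadratic
    one.\<close>
  define E where "E = max 0 (\<alpha> - F x0)"
  define n where "n = real CARD('k)"
  define C1 where "C1 = 2 * (n * (1 / \<sigma>)) + 2 * (E / g\<^sup>2)"
  have C1: "0 \<le> C1" unfolding C1_def E_def n_def using \<sigma> by simp
  define C where "C = (real (card P) * H)\<^sup>2 * C1"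
  have lin: "(\<Sum>p\<in>P. G x0 p * (x p - x0 p)) = (\<Sum>p\<in>I. G x0 p * x p)" for x
  proof -
    have "(\<Sum>p\<in>P. G x0 p * (x p - x0 p)) = (\<Sum>p\<in>I. G x0 p * (x p - x0 p))"
      using IP finP by (intro sum.mono_neutral_right) (auto simp: I_def)
    then show ?thesis using xI by simp
  qed
  show thesis
  proof
    show "0 \<le> C" unfolding C_def using C1 by simp
    fix x assume x: "feasible x" "F x \<le> \<alpha>"
    define d where "d = F x - F x0"
    have d: "0 \<le> d" "d \<le> E" using x0(2)[OF x(1)] x(2) unfolding d_def E_def by auto
    have zB: "\<bar>z x k\<bar> \<le> B" "\<bar>z x0 k\<bar> \<le> B" for k using B(2)[of x] B(2)[of x0] x x0 by auto
    have breg: "\<sigma> * (z x k - z x0 k)\<^sup>2 \<le> \<mu> k * (exp (z x k) - exp (z x0 k) - exp (z x0 k) * (z x k - z x0 k))" for k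
    proof -
      have "\<sigma> * (z x k - z x0 k)\<^sup>2 = m * (exp (- (3 * B)) / 2 * (z x k - z x0 k)\<^sup>2)" unfolding \<sigma>_def by simp
      also have "\<dots> \<le> \<mu> k * (exp (z x k) - exp (z x0 k) - exp (z x0 k) * (z x k - z x0 k))"
        using m less_imp_le[OF \<mu>] by (intro mult_mono m(2) exp_bregman_lower zB) auto
      finally show ?thesis .
    qed
    have nonneg: "0 \<le> G x0 p * x p" if "p \<in> I" for p
      using GI[OF that] x(1) IQ that unfolding feasible_def by (auto intro!: mult_nonpos_nonpos)
    have dd: "d = (\<Sum>k\<in>UNIV. \<mu> k * (exp (z x k) - exp (z x0 k) - exp (z x0 k) * (z x k - z x0 k))) + (\<Sum>p\<in>I. G x0 p * x p)"
      unfolding d_def F_expand lin ..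
    have "(\<Sum>k\<in>UNIV. \<sigma> * (z x k - z x0 k)\<^sup>2) \<le> d"
      unfolding dd by (intro add_increasing2 sum_mono sum_nonneg breg nonneg)
    then have z2: "(\<Sum>k\<in>UNIV. (z x k - z x0 k)\<^sup>2) \<le> 1 / \<sigma> * d"
      using \<sigma> unfolding sum_distrib_left[symmetric] by (simp add: field_simps)
    have "(\<Sum>k\<in>UNIV. \<bar>z x k - z x0 k\<bar>)\<^sup>2 \<le> n * (\<Sum>k\<in>UNIV. (z x k - z x0 k)\<^sup>2)"
      unfolding n_def by (rule sum_abs_power2_le)
    also have "\<dots> \<le> n * (1 / \<sigma> * d)" using z2 unfolding n_def by (intro mult_left_mono) auto
    finally have sz: "(\<Sum>k\<in>UNIV. \<bar>z x k - z x0 k\<bar>)\<^sup>2 \<le> n * (1 / \<sigma>) * d" by (simp add: mult.assoc)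
    have "g * (\<Sum>p\<in>I. \<bar>x p - x0 p\<bar>) = (\<Sum>p\<in>I. g * \<bar>x p\<bar>)" using xI by (simp add: sum_distrib_left)
    also have "\<dots> \<le> (\<Sum>p\<in>I. G x0 p * x p)"
    proof (rule sum_mono)
      fix p assume p: "p \<in> I"
      then have "x p \<le> 0" using x(1) IQ unfolding feasible_def by auto
      then show "g * \<bar>x p\<bar> \<le> G x0 p * x p"
        using g(2)[OF p] mult_right_mono[of g "- G x0 p" "- x p"] by simp
    qed
    also have "\<dots> \<le> d" unfolding dd
      using less_imp_le[OF \<mu>] exp_bregman_nonneg by (simp add: sum_nonneg)
    finally have "(\<Sum>p\<in>I. \<bar>x p - x0 p\<bar>) \<le> d / g" using g(1) by (simp add: field_simps)
    then have "(\<Sum>p\<in>I. \<bar>x p - x0 p\<bar>)\<^sup>2 \<le> (d / g)\<^sup>2" by (intro power_mono sum_nonneg) auto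
    also have "\<dots> = d * d / g\<^sup>2" by (simp add: power2_eq_square)
    also have "\<dots> \<le> E * d / g\<^sup>2" using d by (intro divide_right_mono mult_right_mono) auto
    finally have sI: "(\<Sum>p\<in>I. \<bar>x p - x0 p\<bar>)\<^sup>2 \<le> E / g\<^sup>2 * d" by simp
    define v where "v = (\<Sum>k\<in>UNIV. \<bar>z x k - z x0 k\<bar>) + (\<Sum>p\<in>I. \<bar>x p - x0 p\<bar>)"
    have "v\<^sup>2 \<le> 2 * (\<Sum>k\<in>UNIV. \<bar>z x k - z x0 k\<bar>)\<^sup>2 + 2 * (\<Sum>p\<in>I. \<bar>x p - x0 p\<bar>)\<^sup>2"
      unfolding v_def 
      using sum_squares_bound[of "\<Sum>k\<in>UNIV. \<bar>z x k - z x0 k\<bar>" "\<Sum>p\<in>I. \<bar>x p - x0 p\<bar>"]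
      unfolding power2_sum by linarith
    also have "\<dots> \<le> 2 * (n * (1 / \<sigma>) * d) + 2 * (E / g\<^sup>2 * d)"
      by (intro add_mono mult_left_mono sz sI) auto
    finally have v: "v\<^sup>2 \<le> C1 * d" unfolding C1_def by (simp add: algebra_simps)
    obtain y where y: "feasible y" "\<And>k. z y k = z x0 k" "\<And>p. p \<in> I \<Longrightarrow> y p = x0 p" "\<And>p. p \<in> P \<Longrightarrow> \<bar>x p - y p\<bar> \<le> H * v"
      using H(2)[OF x(1) x0(1)] unfolding v_def by blast
    have "F y - F x0 = 0" unfolding F_expand lin using y(2,3) xI by simp
    moreover have "(\<Sum>p\<in>P. \<bar>x p - y p\<bar>)\<^sup>2 \<le> C * (F x - F x0)"
    proof -
      have "(\<Sum>p\<in>P. \<bar>x p - y p\<bar>) \<le> real (card P) * (H * v)" using y(4) by (intro sum_bounded_above)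
      then have "(\<Sum>p\<in>P. \<bar>x p - y p\<bar>)\<^sup>2 \<le> (real (card P) * (H * v))\<^sup>2" by (intro power_mono sum_nonneg) auto
      also have "\<dots> = (real (card P) * H)\<^sup>2 * v\<^sup>2" by (simp add: power_mult_distrib)
      also have "\<dots> \<le> (real (card P) * H)\<^sup>2 * (C1 * d)" using v by (intro mult_left_mono) auto
      finally show ?thesis unfolding C_def d_def by (simp add: mult.assoc)
    qed
    ultimately show "\<exists>y. feasible y \<and> F y = F x0 \<and> (\<Sum>p\<in>P. \<bar>x p - y p\<bar>)\<^sup>2 \<le> C * (F x - F x0)"
      using y(1) by auto
  qed
qed

section \<open>Linear convergence of block descent\<close>

lemma z_diff_orthogonal:
  assumes "\<And>p. p \<in> P - J \<Longrightarrow> v p = w p"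
    and "\<And>p q. p \<in> J \<Longrightarrow> q \<in> J \<Longrightarrow> p \<noteq> q \<Longrightarrow> a p k * a q k = 0"
  shows "(z v k - z w k)\<^sup>2 = (\<Sum>p\<in>P. (v p - w p)\<^sup>2 * (a p k)\<^sup>2)"
proof -
  have "(z v k - z w k)\<^sup>2 = (\<Sum>p\<in>P. \<Sum>q\<in>P. ((v p - w p) * a p k) * ((v q - w q) * a q k))"
    unfolding z_diff power2_eq_square by (rule sum_product)
  also have "\<dots> = (\<Sum>p\<in>P. \<Sum>q\<in>P. if q = p then (v p - w p)\<^sup>2 * (a p k)\<^sup>2 else 0)"
  proof (intro sum.cong refl)
    fix p q assume pq: "p \<in> P" "q \<in> P"
    \<comment> \<open>Cross terms vanish: off \<open>J\<close> the difference is zero, and two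
      columns in \<open>J\<close> have disjoint supports.\<close>
    have "(v p - w p) * (v q - w q) * (a p k * a q k) = 0" if "q \<noteq> p"
      using assms pq that by (cases "p \<in> J"; cases "q \<in> J") auto
    then show "((v p - w p) * a p k) * ((v q - w q) * a q k) = (if q = p then (v p - w p)\<^sup>2 * (a p k)\<^sup>2 else 0)"
      by (auto simp: power2_eq_square ac_simps)
  qed
  finally show ?thesis using finP by simp
qed

text \<open>\<open>w l i\<close> is the point of sweep \<open>l\<close> after the blocks up to
  \<open>i\<close> have been updated, and \<open>opt\<close> says that it is optimal in block
  \<open>i\<close>. A sweep decreases \<open>F\<close> by a multiple of its squared step, and this
  decrease bounds the remaining gap; together they contract the gap by a fixed factor.\<close>

theorem block_descent_linear:
  fixes x :: "nat \<Rightarrow> 'p \<Rightarrow> real" and blk :: "'p \<Rightarrow> nat" and n :: nat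
  defines "w \<equiv> \<lambda>l i p. if blk p \<le> i then x (Suc l) p else x l p"
  assumes blk: "\<And>p. p \<in> P \<Longrightarrow> blk p \<in> {1..n}"
    and orth: "\<And>p q k. p \<in> P \<Longrightarrow> q \<in> P \<Longrightarrow> p \<noteq> q \<Longrightarrow> blk p = blk q \<Longrightarrow> a p k * a q k = 0"
    and nonzero: "\<And>p. p \<in> P \<Longrightarrow> \<exists>k. a p k \<noteq> 0"
    and feas_x: "\<And>l. feasible (x l)"
    and opt: "\<And>l i v. i \<in> {1..n} \<Longrightarrow> feasible v \<Longrightarrow> (\<And>p. p \<in> P \<Longrightarrow> blk p \<noteq> i \<Longrightarrow> v p = w l i p) \<Longrightarrow>
      F (w l i) \<le> F v"
  obtains x0 c r where "feasible x0" "\<And>v. feasible v \<Longrightarrow> F x0 \<le> F v" "\<And>p. p \<notin> P \<Longrightarrow> x0 p = 0"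
    "0 < c" "0 < r" "r < 1" "\<And>l p. p \<in> P \<Longrightarrow> \<bar>x l p - x0 p\<bar> \<le> c * r ^ l"
    "\<And>l k. \<bar>\<mu> k * exp (z (x l) k) - \<mu> k * exp (z x0 k)\<bar> \<le> c * r ^ l"
proof -
  obtain xm where xm: "feasible xm" "\<And>v. feasible v \<Longrightarrow> F xm \<le> F v" using minimizer_exists by blast
  define \<alpha> where "\<alpha> = F (x 0)"
  obtain B where B: "0 < B" "\<And>x k. feasible x \<Longrightarrow> F x \<le> \<alpha> \<Longrightarrow> \<bar>z x k\<bar> \<le> B"
    by (rule sublevel_bounded[of \<alpha>]) (rule that)
  have w_feas: "feasible (w l i)" for l i using feas_x[of l] feas_x[of "Suc l"] unfolding feasible_def w_def by auto
  \<comment> \<open>Blocks are numbered from 1, so stage 0 of a sweep agrees on \<open>P\<close>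
    with the old iterate and stage \<open>n\<close> with the new one.\<close>
  have w_0: "F (w l 0) = F (x l)" for l
    by (rule F_cong) (use blk in \<open>force simp: w_def\<close>)
  have w_n: "F (w l n) = F (x (Suc l))" for l
    by (rule F_cong) (use blk in \<open>force simp: w_def\<close>)
  have w_off: "w l i p = w l (Suc i) p" if "blk p \<noteq> Suc i" for l i p
    using that unfolding w_def by auto
  have w_step: "F (w l (Suc i)) \<le> F (w l i)" if "i < n" for l i
    using that w_off by (intro opt w_feas) auto
  have w_anti: "F (w l j) \<le> F (w l i)" if "i \<le> j" "j \<le> n" for l i j
    using that(1,2)
  proof (induction j rule: dec_induct)
    case (step j)
    then show ?case using w_step[of j l] by force
  qed auto
  have x_anti: "F (x l) \<le> \<alpha>" for l
  proof (induction l)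
    case (Suc l)
    then show ?case using w_anti[of 0 n l] w_0 w_n by simp
  qed (simp add: \<alpha>_def)
  have w_level: "F (w l i) \<le> \<alpha>" if "i \<le> n" for l i
    using w_anti[of 0 i l] that x_anti[of l] w_0[of l] by simp
  have wB: "\<bar>z (w l i) k\<bar> \<le> B" if "i \<le> n" for l i k using B(2) w_feas w_level that by auto
  have xB: "\<bar>z (x l) k\<bar> \<le> B" for l k using B(2) feas_x x_anti by auto
  define d where "d l p = x (Suc l) p - x l p" for l p
  define D where "D l = (\<Sum>p\<in>P. \<bar>d l p\<bar>)" for l
  have D0: "0 \<le> D l" for l unfolding D_def by (simp add: sum_nonneg)

  \<comment> \<open>The weighted squared norms of the columns are positive because no column
    vanishes; this gives strong convexity within a block.\<close>
  obtain \<rho> where \<rho>: "0 < \<rho>" "\<And>p. p \<in> P \<Longrightarrow> \<rho> \<le> (\<Sum>k\<in>UNIV. \<mu> k * (a p k)\<^sup>2)"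
  proof (rule finite_positive_lower_bound[OF finP, of "\<lambda>p. \<Sum>k\<in>UNIV. \<mu> k * (a p k)\<^sup>2"])
    fix p assume "p \<in> P"
    then obtain k where "a p k \<noteq> 0" using nonzero by blast
    then have "0 < \<mu> k * (a p k)\<^sup>2" using \<mu> by simp
    then show "0 < (\<Sum>k\<in>UNIV. \<mu> k * (a p k)\<^sup>2)"
      using less_imp_le[OF \<mu>] by (intro sum_pos2[of _ k]) auto
  qed blast
  define \<kappa> where "\<kappa> = exp (- (3 * B)) / 2 * \<rho>"
  have \<kappa>: "0 < \<kappa>" unfolding \<kappa>_def using \<rho> by simp
  \<comment> \<open>\<open>F\<close> is expanded at the new point. The variational inequality
    towards the old point discards the first-order term, and the Bregman remainder is bounded below
    by the squared step through orthogonality of the columns.\<close>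
  have decrease_block: "\<kappa> * (\<Sum>p\<in>{p\<in>P. blk p = Suc i}. (d l p)\<^sup>2) \<le> F (w l i) - F (w l (Suc i))" if i: "i < n" for l i
  proof -
    define J where "J = {p\<in>P. blk p = Suc i}"
    have off: "w l i p = w l (Suc i) p" if "p \<in> P - J" for p using w_off that unfolding J_def by auto
    have on: "w l i p - w l (Suc i) p = - d l p" if "p \<in> J" for p using that unfolding J_def w_def d_def by auto
    have VI: "0 \<le> (\<Sum>p\<in>P. G (w l (Suc i)) p * (w l i p - w l (Suc i) p))"
    proof (rule block_minimizer_variational_inequality[of _ _ J])
      fix u assume "feasible u" "\<And>p. p \<in> P - J \<Longrightarrow> u p = w l (Suc i) p"
      then show "F (w l (Suc i)) \<le> F u" using i by (intro opt) (auto simp: J_def)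
    qed (use w_feas off in auto)
    have "\<kappa> * (\<Sum>p\<in>J. (d l p)\<^sup>2) = exp (- (3 * B)) / 2 * (\<Sum>p\<in>J. (d l p)\<^sup>2 * \<rho>)"
      unfolding \<kappa>_def by (simp add: sum_distrib_left ac_simps)
    also have "\<dots> \<le> exp (- (3 * B)) / 2 * (\<Sum>p\<in>J. (d l p)\<^sup>2 * (\<Sum>k\<in>UNIV. \<mu> k * (a p k)\<^sup>2))"
      using \<rho>(2) by (intro mult_left_mono sum_mono) (auto simp: J_def)
    also have "(\<Sum>p\<in>J. (d l p)\<^sup>2 * (\<Sum>k\<in>UNIV. \<mu> k * (a p k)\<^sup>2))
        = (\<Sum>p\<in>P. \<Sum>k\<in>UNIV. \<mu> k * ((w l i p - w l (Suc i) p)\<^sup>2 * (a p k)\<^sup>2))"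
    proof -
      have "(\<Sum>p\<in>P. \<Sum>k\<in>UNIV. \<mu> k * ((w l i p - w l (Suc i) p)\<^sup>2 * (a p k)\<^sup>2))
        = (\<Sum>p\<in>J. \<Sum>k\<in>UNIV. \<mu> k * ((w l i p - w l (Suc i) p)\<^sup>2 * (a p k)\<^sup>2))"
        using finP off by (intro sum.mono_neutral_right) (auto simp: J_def)
      then show ?thesis using on by (simp add: sum_distrib_left ac_simps)
    qed
    also have "\<dots> = (\<Sum>k\<in>UNIV. \<mu> k * (\<Sum>p\<in>P. (w l i p - w l (Suc i) p)\<^sup>2 * (a p k)\<^sup>2))"
      unfolding sum_distrib_left by (rule sum.swap)
    also have "\<dots> = (\<Sum>k\<in>UNIV. \<mu> k * (z (w l i) k - z (w l (Suc i)) k)\<^sup>2)"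
      using off orth by (subst z_diff_orthogonal[of J]) (auto simp: J_def)
    also have "exp (- (3 * B)) / 2 * \<dots> = (\<Sum>k\<in>UNIV. \<mu> k * (exp (- (3 * B)) / 2 * (z (w l i) k - z (w l (Suc i)) k)\<^sup>2))"
      by (simp add: sum_distrib_left ac_simps)
    also have "\<dots> \<le> (\<Sum>k\<in>UNIV. \<mu> k * (exp (z (w l i) k) - exp (z (w l (Suc i)) k)
        - exp (z (w l (Suc i)) k) * (z (w l i) k - z (w l (Suc i)) k)))"
      using wB i less_imp_le[OF \<mu>] by (intro sum_mono mult_left_mono exp_bregman_lower) auto
    also have "\<dots> \<le> F (w l i) - F (w l (Suc i))" unfolding F_expand using VI by simp
    finally show ?thesis unfolding J_def .
  qed
  have decrease: "\<kappa> * (\<Sum>p\<in>P. (d l p)\<^sup>2) \<le> F (x l) - F (x (Suc l))" for l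
  proof -
    have "\<kappa> * (\<Sum>p\<in>{p\<in>P. blk p \<in> {1..j}}. (d l p)\<^sup>2) \<le> F (w l 0) - F (w l j)" if "j \<le> n" for j
      using that
    proof (induction j)
      case (Suc j)
      have "{p\<in>P. blk p \<in> {1..Suc j}} = {p\<in>P. blk p \<in> {1..j}} \<union> {p\<in>P. blk p = Suc j}" by auto
      then have "(\<Sum>p\<in>{p\<in>P. blk p \<in> {1..Suc j}}. (d l p)\<^sup>2)
         = (\<Sum>p\<in>{p\<in>P. blk p \<in> {1..j}}. (d l p)\<^sup>2) + (\<Sum>p\<in>{p\<in>P. blk p = Suc j}. (d l p)\<^sup>2)"
        using finP by (simp only:) (rule sum.union_disjoint; auto)
      then show ?case using Suc decrease_block[of j l] by (simp add: distrib_left)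
    qed auto
    from this[of n] have "\<kappa> * (\<Sum>p\<in>{p\<in>P. blk p \<in> {1..n}}. (d l p)\<^sup>2) \<le> F (x l) - F (x (Suc l))"
      unfolding w_0 w_n by simp
    moreover have "{p\<in>P. blk p \<in> {1..n}} = P" using blk by auto
    ultimately show ?thesis by simp
  qed
  \<comment> \<open>Adding 1 keeps the constant positive even for empty \<open>P\<close>.\<close>
  define C3 where "C3 = (real (card P) + 1) / \<kappa>"
  have C3: "0 < C3" unfolding C3_def using \<kappa> by simp
  have D_decrease: "(D l)\<^sup>2 \<le> C3 * (F (x l) - F (x (Suc l)))" for l
  proof -
    have "(D l)\<^sup>2 \<le> real (card P) * (\<Sum>p\<in>P. (d l p)\<^sup>2)" unfolding D_def by (rule sum_abs_power2_le)
    also have "\<dots> \<le> (real (card P) + 1) * (\<Sum>p\<in>P. (d l p)\<^sup>2)" by (intro mult_right_mono sum_nonneg) auto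
    also have "\<dots> = C3 * (\<kappa> * (\<Sum>p\<in>P. (d l p)\<^sup>2))" unfolding C3_def using \<kappa> by simp
    also have "\<dots> \<le> C3 * (F (x l) - F (x (Suc l)))" using decrease C3 by (intro mult_left_mono) auto
    finally show ?thesis .
  qed

  define A where "A = 1 + (\<Sum>k\<in>UNIV. \<Sum>p\<in>P. \<bar>a p k\<bar>)"
  have A0: "0 < A" unfolding A_def by (smt (verit) abs_ge_zero sum_nonneg)
  have A: "\<bar>a p k\<bar> \<le> A" if "p \<in> P" for p k
  proof -
    have "\<bar>a p k\<bar> \<le> (\<Sum>p\<in>P. \<bar>a p k\<bar>)" using that finP by (intro member_le_sum) auto
    also have "\<dots> \<le> (\<Sum>k\<in>UNIV. \<Sum>p\<in>P. \<bar>a p k\<bar>)" by (intro member_le_sum) (auto intro: sum_nonneg)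
    finally show ?thesis unfolding A_def by simp
  qed
  define \<mu>s where "\<mu>s = (\<Sum>k\<in>UNIV. \<mu> k)"
  have z_lip: "\<bar>z u k - z v k\<bar> \<le> A * (\<Sum>p\<in>P. \<bar>u p - v p\<bar>)" for u v k
  proof -
    have "\<bar>z u k - z v k\<bar> \<le> (\<Sum>p\<in>P. \<bar>u p - v p\<bar> * \<bar>a p k\<bar>)" by (rule abs_z_diff)
    also have "\<dots> \<le> (\<Sum>p\<in>P. \<bar>u p - v p\<bar> * A)" using A by (intro sum_mono mult_left_mono) auto
    finally show ?thesis by (simp add: sum_distrib_left mult.commute)
  qed
  define C1 where "C1 = A * \<mu>s * exp B * A + 1"
  have \<mu>s0: "0 \<le> \<mu>s" unfolding \<mu>s_def using less_imp_le[OF \<mu>] by (intro sum_nonneg)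
  have C1: "0 < C1" unfolding C1_def using A0 \<mu>s0 by (smt (verit) exp_ge_zero mult_nonneg_nonneg)
  \<comment> \<open>Lipschitz continuity of the gradient holds where \<open>z\<close> is bounded by
    \<open>B\<close>, which covers all iterates and intermediate points.\<close>
  have G_lip: "\<bar>G u p - G v p\<bar> \<le> C1 * (\<Sum>p\<in>P. \<bar>u p - v p\<bar>)"
    if "\<And>k. \<bar>z u k\<bar> \<le> B" "\<And>k. \<bar>z v k\<bar> \<le> B" "p \<in> P" for u v p
  proof -
    define s where "s = (\<Sum>p\<in>P. \<bar>u p - v p\<bar>)"
    have s0: "0 \<le> s" unfolding s_def by (simp add: sum_nonneg)
    have "\<bar>G u p - G v p\<bar> = \<bar>\<Sum>k\<in>UNIV. a p k * (\<mu> k * (exp (z u k) - exp (z v k)))\<bar>"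
      unfolding G_def by (simp add: sum_subtractf algebra_simps)
    also have "\<dots> \<le> (\<Sum>k\<in>UNIV. \<bar>a p k\<bar> * (\<mu> k * \<bar>exp (z u k) - exp (z v k)\<bar>))"
      using less_imp_le[OF \<mu>] by (intro order_trans[OF sum_abs]) (simp add: abs_mult)
    also have "\<dots> \<le> (\<Sum>k\<in>UNIV. A * (\<mu> k * (exp B * (A * s))))"
    proof (intro sum_mono mult_mono)
      fix k
      have "\<bar>exp (z u k) - exp (z v k)\<bar> \<le> exp B * \<bar>z u k - z v k\<bar>" using that by (intro exp_lipschitz)
      also have "\<dots> \<le> exp B * (A * s)" using z_lip unfolding s_def by (intro mult_left_mono) auto
      finally show "\<bar>exp (z u k) - exp (z v k)\<bar> \<le> exp B * (A * s)" .
    qed (use A[OF that(3)] less_imp_le[OF \<mu>] A0 in auto)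
    also have "\<dots> = A * \<mu>s * exp B * A * s" unfolding \<mu>s_def
      by (simp add: sum_distrib_left sum_distrib_right ac_simps)
    also have "\<dots> \<le> C1 * s" unfolding C1_def using s0 by (intro mult_right_mono) auto
    finally show ?thesis unfolding s_def .
  qed
  obtain C2 where C2: "0 \<le> C2" "\<And>x. feasible x \<Longrightarrow> F x \<le> \<alpha> \<Longrightarrow>
    \<exists>y. feasible y \<and> F y = F xm \<and> (\<Sum>p\<in>P. \<bar>x p - y p\<bar>)\<^sup>2 \<le> C2 * (F x - F xm)"
    by (rule quadratic_growth[OF xm, of \<alpha>]) (assumption, rule that)
  define \<Delta> where "\<Delta> l = F (x l) - F xm" for l
  have \<Delta>0: "0 \<le> \<Delta> l" for l unfolding \<Delta>_def using xm(2) feas_x by simp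
  define C where "C = C1\<^sup>2 * C2 * C3 + 1"
  have C: "0 < C" unfolding C_def using C2 C3 by (smt (verit) mult_nonneg_nonneg zero_le_power2)
  have cost_to_go: "\<Delta> (Suc l) \<le> C * (\<Delta> l - \<Delta> (Suc l))" for l
  proof -
    define u where "u = x (Suc l)"
    obtain y where y: "feasible y" "F y = F xm" "(\<Sum>p\<in>P. \<bar>u p - y p\<bar>)\<^sup>2 \<le> C2 * \<Delta> (Suc l)"
      using C2(2)[OF feas_x[of "Suc l"] x_anti[of "Suc l"]] unfolding \<Delta>_def u_def by blast
    define s where "s = (\<Sum>p\<in>P. \<bar>u p - y p\<bar>)"
    have s0: "0 \<le> s" unfolding s_def by (simp add: sum_nonneg)
    \<comment> \<open>Below, \<open>v\<close> is the point just after the block of \<open>p\<close>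
      was minimized; its optimality fixes the sign of \<open>G v p * (y p - v p)\<close>. It differs
      from \<open>u\<close> on \<open>P\<close> only by later updates of the same sweep, so passing
      from \<open>G v p\<close> to \<open>G u p\<close> costs at most
      \<open>C1 * D l\<close>.\<close>
    have coord: "G u p * (u p - y p) \<le> C1 * D l * \<bar>u p - y p\<bar>" if p: "p \<in> P" for p
    proof -
      define v where "v = w l (blk p)"
      have i: "blk p \<in> {1..n}" using blk p by auto
      have vp: "v p = u p" unfolding v_def u_def w_def by simp
      have "0 \<le> G v p * (y p - v p)" unfolding v_def
      proof (rule block_minimizer_coordinate[of _ _ "{q\<in>P. blk q = blk p}"])
        fix u assume "feasible u" "\<And>q. q \<in> P - {q\<in>P. blk q = blk p} \<Longrightarrow> u q = w l (blk p) q"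
        then show "F (w l (blk p)) \<le> F u" using i by (intro opt) auto
      qed (use w_feas p y(1) in \<open>auto simp: feasible_def\<close>)
      then have "G u p * (u p - y p) \<le> (G u p - G v p) * (u p - y p)"
        unfolding vp by (simp add: algebra_simps)
      also have "\<dots> \<le> \<bar>G u p - G v p\<bar> * \<bar>u p - y p\<bar>" by (metis abs_ge_self abs_mult)
      also have "\<dots> \<le> C1 * (\<Sum>p\<in>P. \<bar>u p - v p\<bar>) * \<bar>u p - y p\<bar>"
        using xB wB i p unfolding u_def v_def by (intro mult_right_mono G_lip) auto
      also have "\<dots> \<le> C1 * D l * \<bar>u p - y p\<bar>"
        unfolding D_def d_def u_def v_def w_def using C1
        by (intro mult_right_mono mult_left_mono sum_mono) auto
      finally show ?thesis .
    qed
    have "\<Delta> (Suc l) = F u - F y" unfolding \<Delta>_def u_def y(2) ..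
    also have "\<dots> \<le> (\<Sum>p\<in>P. G u p * (u p - y p))"
    proof -
      have "(\<Sum>p\<in>P. G u p * (y p - u p)) = - (\<Sum>p\<in>P. G u p * (u p - y p))"
        by (simp add: sum_negf[symmetric] algebra_simps)
      then show ?thesis using F_ge_linear[of u y] by linarith
    qed
    also have "\<dots> \<le> (\<Sum>p\<in>P. C1 * D l * \<bar>u p - y p\<bar>)" by (intro sum_mono coord)
    also have "\<dots> = C1 * D l * s" unfolding s_def by (simp add: sum_distrib_left)
    \<comment> \<open>After squaring, \<open>D l\<close> is bounded by the decrease of the sweep and
      \<open>s\<close> by quadratic growth. A common factor \<open>\<Delta> (Suc l)\<close> then
      cancels, the case of a vanishing gap being trivial.\<close>
    finally have "(\<Delta> (Suc l))\<^sup>2 \<le> (C1 * D l * s)\<^sup>2" using \<Delta>0 by (intro power_mono) auto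
    also have "\<dots> = C1\<^sup>2 * (D l)\<^sup>2 * s\<^sup>2" by (simp add: power_mult_distrib)
    also have "\<dots> \<le> C1\<^sup>2 * (C3 * (\<Delta> l - \<Delta> (Suc l))) * (C2 * \<Delta> (Suc l))"
      using D_decrease[of l] y(3) unfolding s_def[symmetric] \<Delta>_def
      by (intro mult_mono mult_left_mono mult_nonneg_nonneg) (use C3 w_anti[of 0 n l] w_0 w_n in auto)
    finally have "\<Delta> (Suc l) * \<Delta> (Suc l) \<le> C1\<^sup>2 * C2 * C3 * (\<Delta> l - \<Delta> (Suc l)) * \<Delta> (Suc l)"
      by (simp add: power2_eq_square ac_simps)
    then have "\<Delta> (Suc l) \<le> C1\<^sup>2 * C2 * C3 * (\<Delta> l - \<Delta> (Suc l)) \<or> \<Delta> (Suc l) = 0"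
      using \<Delta>0[of "Suc l"] by (metis mult_le_cancel_right not_less_iff_gr_or_eq order_le_less)
    moreover have "0 \<le> \<Delta> l - \<Delta> (Suc l)" unfolding \<Delta>_def using w_anti[of 0 n l] w_0 w_n by simp
    moreover have "0 \<le> C1\<^sup>2 * C2 * C3" using C2 C3 by simp
    ultimately have "\<Delta> (Suc l) \<le> C1\<^sup>2 * C2 * C3 * (\<Delta> l - \<Delta> (Suc l))"
      by (metis mult_nonneg_nonneg)
    then show ?thesis unfolding C_def using \<open>0 \<le> \<Delta> l - \<Delta> (Suc l)\<close> by (simp add: distrib_right)
  qed
  \<comment> \<open>Solving
    \<open>\<Delta> (Suc l) \<le> C * (\<Delta> l - \<Delta> (Suc l))\<close> for the new gap gives
    this contraction factor.\<close>
  define q where "q = C / (1 + C)"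
  have q: "0 < q" "q < 1" unfolding q_def using C by auto
  have \<Delta>q: "\<Delta> l \<le> \<Delta> 0 * q ^ l" for l
  proof (induction l)
    case (Suc l)
    have "\<Delta> (Suc l) \<le> q * \<Delta> l" using cost_to_go[of l] C unfolding q_def by (simp add: field_simps)
    also have "\<dots> \<le> q * (\<Delta> 0 * q ^ l)" using Suc q by (intro mult_left_mono) auto
    finally show ?case by (simp add: ac_simps)
  qed auto
  \<comment> \<open>Steps are bounded by square roots of gaps, hence the square root of the
    rate.\<close>
  define r where "r = sqrt q"
  have r: "0 < r" "r < 1" unfolding r_def using q by auto
  define c0 where "c0 = sqrt (C3 * \<Delta> 0)"
  have D_geom: "D l \<le> c0 * r ^ l" for l
  proof -
    have "(D l)\<^sup>2 \<le> C3 * (\<Delta> l - \<Delta> (Suc l))" using D_decrease[of l] unfolding \<Delta>_def by simp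
    also have "\<dots> \<le> C3 * (\<Delta> 0 * q ^ l)" using \<Delta>q[of l] \<Delta>0[of "Suc l"] C3 by (intro mult_left_mono) auto
    finally have "D l \<le> sqrt (C3 * (\<Delta> 0 * q ^ l))" using D0 real_le_rsqrt by blast
    then show ?thesis unfolding c0_def r_def by (simp add: real_sqrt_mult real_sqrt_power mult.assoc)
  qed
  have "\<bar>x (Suc l) p - x l p\<bar> \<le> c0 * r ^ l" if "p \<in> P" for p l
  proof -
    have "\<bar>d l p\<bar> \<le> D l" unfolding D_def using that finP by (intro member_le_sum) auto
    then show ?thesis using D_geom[of l] unfolding d_def by linarith
  qed
  then have "\<exists>L. (\<lambda>l. x l p) \<longlonglongrightarrow> L \<and> (\<forall>l. \<bar>x l p - L\<bar> \<le> c0 / (1 - r) * r ^ l)" if "p \<in> P" for p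
    using geometric_steps_converge[of "\<lambda>l. x l p" c0 r] that r by (metis less_imp_le)
  then obtain x1 where x1: "\<And>p. p \<in> P \<Longrightarrow> (\<lambda>l. x l p) \<longlonglongrightarrow> x1 p"
    "\<And>p l. p \<in> P \<Longrightarrow> \<bar>x l p - x1 p\<bar> \<le> c0 / (1 - r) * r ^ l" by metis
  define x0 where "x0 p = (if p \<in> P then x1 p else 0)" for p
  define c1 where "c1 = c0 / (1 - r)"
  have c1: "0 \<le> c1" unfolding c1_def c0_def using r C3 \<Delta>0 by auto
  have lim: "(\<lambda>l. x l p) \<longlonglongrightarrow> x0 p" "\<bar>x l p - x0 p\<bar> \<le> c1 * r ^ l" if "p \<in> P" for p l
    using x1 that unfolding x0_def c1_def by auto
  have zlim: "(\<lambda>l. z (x l) k) \<longlonglongrightarrow> z x0 k" for k unfolding z_def using lim by (intro tendsto_intros) auto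
  have x0_feas: "feasible x0" unfolding feasible_def
  proof
    fix p assume p: "p \<in> Q"
    then have "(\<lambda>l. x l p) \<longlonglongrightarrow> x0 p" using lim QP by auto
    then show "x0 p \<le> 0" using feas_x p unfolding feasible_def by (intro LIMSEQ_le_const2) auto
  qed
  have "(\<lambda>l. F (x l)) \<longlonglongrightarrow> F x0" unfolding F_def using lim zlim by (intro tendsto_intros) auto
  moreover have "(\<lambda>l. F (x l)) \<longlonglongrightarrow> F xm"
  proof -
    have "(\<lambda>l. \<Delta> 0 * q ^ l) \<longlonglongrightarrow> \<Delta> 0 * 0" using q by (intro tendsto_intros LIMSEQ_realpow_zero) auto
    then have "\<Delta> \<longlonglongrightarrow> 0"
      using \<Delta>0 \<Delta>q by (intro tendsto_sandwich[of "\<lambda>_. 0" \<Delta> sequentially "\<lambda>l. \<Delta> 0 * q ^ l" 0]) auto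
    then have "(\<lambda>l. \<Delta> l + F xm) \<longlonglongrightarrow> 0 + F xm" by (intro tendsto_intros)
    then show ?thesis unfolding \<Delta>_def by simp
  qed
  \<comment> \<open>The limit \<open>x0\<close> need not be the minimizer \<open>xm\<close> chosen
    at the start, but it attains the same value.\<close>
  ultimately have Fx0: "F x0 = F xm" using LIMSEQ_unique by blast
  have z0B: "\<bar>z x0 k\<bar> \<le> B" for k
    using tendsto_rabs[OF zlim[of k]] xB by (intro LIMSEQ_le_const2) auto
  define c2 where "c2 = \<mu>s * exp B * A * (real (card P) * c1)"
  have c2: "0 \<le> c2" unfolding c2_def using \<mu>s0 A0 c1 by auto
  \<comment> \<open>Both exponents lie in the interval from \<open>- B\<close> to \<open>B\<close>,
    where \<open>exp\<close> is Lipschitz, so the rate of the iterates carries over.\<close>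
  have X: "\<bar>\<mu> k * exp (z (x l) k) - \<mu> k * exp (z x0 k)\<bar> \<le> c2 * r ^ l" for l k
  proof -
    have "\<bar>\<mu> k * exp (z (x l) k) - \<mu> k * exp (z x0 k)\<bar> = \<mu> k * \<bar>exp (z (x l) k) - exp (z x0 k)\<bar>"
      using less_imp_le[OF \<mu>[of k]] by (simp add: right_diff_distrib[symmetric] abs_mult)
    also have "\<dots> \<le> \<mu>s * (exp B * (A * (real (card P) * (c1 * r ^ l))))"
    proof (intro mult_mono)
      show "\<mu> k \<le> \<mu>s" unfolding \<mu>s_def using less_imp_le[OF \<mu>] by (intro member_le_sum) auto
      have "\<bar>exp (z (x l) k) - exp (z x0 k)\<bar> \<le> exp B * \<bar>z (x l) k - z x0 k\<bar>"
        using xB z0B by (intro exp_lipschitz)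
      also have "\<dots> \<le> exp B * (A * (\<Sum>p\<in>P. \<bar>x l p - x0 p\<bar>))" using z_lip by (intro mult_left_mono) auto
      also have "\<dots> \<le> exp B * (A * (real (card P) * (c1 * r ^ l)))"
        using lim(2) A0 by (intro mult_left_mono sum_bounded_above) auto
      finally show "\<bar>exp (z (x l) k) - exp (z x0 k)\<bar> \<le> exp B * (A * (real (card P) * (c1 * r ^ l)))" .
    qed (use \<mu>s0 in auto)
    finally show ?thesis unfolding c2_def by (simp add: ac_simps)
  qed
  define c where "c = c1 + c2 + 1"
  have up: "e \<le> c * r ^ l" if "e \<le> c1 * r ^ l \<or> e \<le> c2 * r ^ l" for e l
  proof -
    have "c1 * r ^ l \<le> c * r ^ l" "c2 * r ^ l \<le> c * r ^ l"
      unfolding c_def using c1 c2 r by (auto intro!: mult_right_mono)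
    then show ?thesis using that by linarith
  qed
  show thesis
  proof (rule that[of x0 c r])
    show "feasible x0" by fact
    show "F x0 \<le> F v" if "feasible v" for v using xm(2)[OF that] Fx0 by simp
    show "x0 p = 0" if "p \<notin> P" for p using that unfolding x0_def by simp
    show "0 < c" unfolding c_def using c1 c2 by simp
    show "0 < r" "r < 1" by fact+
    show "\<bar>x l p - x0 p\<bar> \<le> c * r ^ l" if "p \<in> P" for l p using lim(2)[OF that] up by blast
    show "\<bar>\<mu> k * exp (z (x l) k) - \<mu> k * exp (z x0 k)\<bar> \<le> c * r ^ l" for l k using X up by blast
  qed
qed

end

section \<open>The entropic tensor program\<close>

text \<open>Flattening the three indices to one triple lets
  \<open>'a \<times> 'b \<times> 'c\<close> play the role of \<open>'k\<close> in
  \<open>exp_program\<close>.\<close>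

definition entry :: "('a::finite, 'b::finite, 'c::finite) tensor \<Rightarrow> 'a \<times> 'b \<times> 'c \<Rightarrow> real"
  where "entry X = (\<lambda>(r, s, t). X $ r $ s $ t)"

lemma sum_triples: "(\<Sum>r\<in>UNIV. \<Sum>s\<in>UNIV. \<Sum>t\<in>UNIV. f r s t) = (\<Sum>(r, s, t)\<in>UNIV. f r s t)"
  by (simp add: sum.cartesian_product UNIV_Times_UNIV case_prod_beta)

lemma inner_entry: "X \<bullet> Y = (\<Sum>k\<in>UNIV. entry X k * entry Y k)"
  unfolding inner_vec_def inner_real_def sum_triples entry_def by (simp add: case_prod_beta)

lemma entry_simps [simp]:
  "entry (X + Y) k = entry X k + entry Y k" "entry (X - Y) k = entry X k - entry Y k"
  "entry (- X) k = - entry X k" "entry (c *\<^sub>R X) k = c * entry X k" "entry 0 k = 0"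
  "entry (X * Y) k = entry X k * entry Y k" "entry (tmap f X) k = f (entry X k)"
  unfolding entry_def tmap_def by (auto simp: case_prod_beta)

lemma entry_sum [simp]: "entry (\<Sum>i\<in>I. f i) k = (\<Sum>i\<in>I. entry (f i) k)"
  by (induction I rule: infinite_finite_induct) auto

lemma tensor_eq_iff: "X = Y \<longleftrightarrow> (\<forall>k. entry X k = entry Y k)"
  unfolding entry_def vec_eq_iff by auto

lemma tensor_le_0_iff: "X \<le> 0 \<longleftrightarrow> (\<forall>k. entry X k \<le> 0)"
  unfolding entry_def less_eq_vec_def by auto

lemma tensor_ge_0_iff: "0 \<le> X \<longleftrightarrow> (\<forall>k. 0 \<le> entry X k)"
  unfolding entry_def less_eq_vec_def by auto

lemma positive_tensor_iff: "positive_tensor X \<longleftrightarrow> (\<forall>k. 0 < entry X k)"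
  unfolding entry_def positive_tensor_def by auto

lemma norm_le_sum_entries: "norm X \<le> (\<Sum>k\<in>UNIV. \<bar>entry X k\<bar>)"
proof -
  have *: "norm x \<le> (\<Sum>i\<in>UNIV. norm (x $ i))" for x :: "'v::real_normed_vector ^ 'n"
    unfolding norm_vec_def by (rule L2_set_le_sum) simp
  have "norm X \<le> (\<Sum>r\<in>UNIV. norm (X $ r))" by (rule *)
  also have "\<dots> \<le> (\<Sum>r\<in>UNIV. \<Sum>s\<in>UNIV. norm (X $ r $ s))" by (intro sum_mono *)
  also have "\<dots> \<le> (\<Sum>r\<in>UNIV. \<Sum>s\<in>UNIV. \<Sum>t\<in>UNIV. norm (X $ r $ s $ t))" by (intro sum_mono *)
  finally show ?thesis unfolding sum_triples entry_def by (simp add: case_prod_beta)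
qed

definition of_entries :: "('a \<times> 'b \<times> 'c \<Rightarrow> real) \<Rightarrow> ('a::finite, 'b::finite, 'c::finite) tensor"
  where "of_entries f = (\<chi> r s t. f (r, s, t))"

lemma entry_of_entries [simp]: "entry (of_entries f) k = f k"
  unfolding entry_def of_entries_def by (auto simp: case_prod_beta)

section \<open>The entropy, its gradient and the primal objective\<close>

definition entropy_sum :: "('a::finite, 'b::finite, 'c::finite) tensor \<Rightarrow> real"
  where "entropy_sum X = (\<Sum>k\<in>UNIV. entry X k * ln (entry X k) - entry X k)"

lemma entropy_eq: "entropy X = (if 0 \<le> X then ereal (entropy_sum X) else \<infinity>)"
  unfolding entropy_def entropy_sum_def sum_triples entry_def by (simp add: case_prod_beta)

lemma bounded_linear_entry: "bounded_linear (\<lambda>X. entry X k)"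
  unfolding entry_def case_prod_beta
  by (intro bounded_linear_compose[OF bounded_linear_vec_nth] bounded_linear_vec_nth)

text \<open>Near a positive tensor the entropy is finite and equals \<open>entropy_sum\<close>,
  whose derivative is computed entrywise. Uniqueness of derivatives then evaluates the definite
  description in \<open>gradient\<close>.\<close>

lemma gradient_entropy:
  assumes "positive_tensor S"
  shows "gradient entropy S = tmap ln S"
proof -
  let ?f = "\<lambda>X. real_of_ereal (entropy X)"
  have pos: "0 < entry S k" for k using assms unfolding positive_tensor_iff by blast
  have "(entropy_sum has_derivative (\<lambda>H. \<Sum>k\<in>UNIV. entry H k * ln (entry S k))) (at S)"
    unfolding entropy_sum_def
  proof (intro has_derivative_sum)
    fix k
    note d = bounded_linear_imp_has_derivative[OF bounded_linear_entry]
    show "((\<lambda>X. entry X k * ln (entry X k) - entry X k) has_derivative (\<lambda>H. entry H k * ln (entry S k))) (at S)"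
      by (rule derivative_eq_intros d refl pos)+ (use pos[of k] in \<open>auto simp: fun_eq_iff field_simps\<close>)
  qed
  moreover have "open {X. \<forall>k. 0 < entry X k}"
  proof -
    have "open (\<Inter>k\<in>UNIV. {X. 0 < entry X k})"
      by (intro open_INT ballI open_Collect_less continuous_intros
          linear_continuous_on[OF bounded_linear_entry]) auto
    then show ?thesis by (simp add: Collect_all_eq del: split_paired_All)
  qed
  ultimately have "(?f has_derivative (\<lambda>H. \<Sum>k\<in>UNIV. entry H k * ln (entry S k))) (at S)"
    by (rule has_derivative_transform_within_open)
      (use pos in \<open>auto simp: entropy_eq tensor_ge_0_iff less_imp_le\<close>)
  then have D: "GDERIV ?f S :> tmap ln S"
    unfolding gderiv_def inner_entry by simp
  show ?thesis unfolding gradient_def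
  proof (rule the_equality)
    show "GDERIV ?f S :> tmap ln S" by (rule D)
    fix E assume "GDERIV ?f S :> E"
    then have "(\<lambda>H. H \<bullet> E) = (\<lambda>H. H \<bullet> tmap ln S)"
      using D has_derivative_unique unfolding gderiv_def by blast
    then show "E = tmap ln S" by (metis vector_eq_ldot)
  qed
qed

text \<open>The tangent inequality of a convex function, with \<open>Z\<close> allowed on the
  boundary. Entrywise it is \<open>ln w \<le> w - 1\<close> at \<open>w = x / z\<close>; for
  \<open>z = 0\<close> it reduces to \<open>0 \<le> x\<close>.\<close>

lemma entropy_sum_gradient_ineq:
  assumes "0 \<le> Z" "\<And>k. 0 < entry X k"
  shows "tmap ln X \<bullet> (Z - X) \<le> entropy_sum Z - entropy_sum X"
proof -
  have *: "ln x * (z - x) \<le> (z * ln z - z) - (x * ln x - x)" if "0 \<le> z" "0 < x" for z x :: real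
  proof (cases "z = 0")
    case False
    then have z: "0 < z" using that by simp
    then have "ln (x / z) \<le> x / z - 1" using that by (intro ln_le_minus_one) simp
    then have "z * (ln x - ln z) \<le> z * (x / z - 1)" using z that by (intro mult_left_mono) (auto simp: ln_div)
    then show ?thesis using z by (simp add: algebra_simps)
  qed (use that in auto)
  show ?thesis unfolding inner_entry entropy_sum_def sum_subtractf[symmetric]
    using assms * by (intro sum_mono) (simp add: tensor_ge_0_iff del: split_paired_All)
qed

lemma primal_obj_eq:
  assumes "positive_tensor S" "0 < \<epsilon>"
  shows "primal_obj C \<epsilon> S X = (if 0 \<le> X
    then ereal (C \<bullet> X + \<epsilon> * (entropy_sum X - entropy_sum S - tmap ln S \<bullet> (X - S))) else \<infinity>)"
proof -
  have "0 \<le> S" using assms unfolding positive_tensor_iff tensor_ge_0_iff by (auto intro: less_imp_le)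
  then show ?thesis
    unfolding primal_obj_def bregman_def gradient_entropy[OF assms(1)] entropy_eq using assms by simp
qed

lemma bounded_above_by_iff: "bounded_above_by X U \<longleftrightarrow> (\<forall>r s t. ereal (entry X (r, s, t)) \<le> U $ r $ s $ t)"
  unfolding bounded_above_by_def entry_def by auto

lemma is_unique_arg_min_le: "is_unique_arg_min f S x \<Longrightarrow> z \<in> S \<Longrightarrow> f x \<le> f z"
  unfolding is_unique_arg_min_def is_arg_min_def by (auto simp: not_less)

section \<open>The dual problem as an exponential program\<close>

definition encode :: "(nat \<Rightarrow> nat \<Rightarrow> real) \<Rightarrow> ('a::finite, 'b::finite, 'c::finite) tensor \<Rightarrow>
    nat \<times> nat + 'a \<times> 'b \<times> 'c \<Rightarrow> real"
  where "encode y W p = (case p of Inl (i, j) \<Rightarrow> y i j | Inr k \<Rightarrow> entry W k)"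

lemma encode_simps [simp]: "encode y W (Inl (i, j)) = y i j" "encode y W (Inr k) = entry W k"
  unfolding encode_def by auto

locale tensor_program =
  fixes C S :: "('a::finite, 'b::finite, 'c::finite) tensor"
    and \<epsilon> :: real
    and U :: "('a, 'b, 'c) etensor"
    and N :: nat
    and m :: "nat \<Rightarrow> nat"
    and A :: "nat \<Rightarrow> nat \<Rightarrow> ('a, 'b, 'c) tensor"
    and b :: "nat \<Rightarrow> nat \<Rightarrow> real"
    and Xh :: "('a, 'b, 'c) tensor"
  assumes upper: "upper_bound_tensor U"
    and b: "\<And>i. i \<in> {1..N} \<Longrightarrow> b i \<in> rvec (m i)"
    and orthogonal: "\<And>i j k. i \<in> {1..N} \<Longrightarrow> j \<in> {1..m i} \<Longrightarrow> k \<in> {1..m i} \<Longrightarrow> j \<noteq> k \<Longrightarrow> A i j * A i k = 0"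
    and S: "positive_tensor S"
    and \<epsilon>: "\<epsilon> > 0"
    and Xh: "Xh \<in> feasible_set N m A b U" "positive_tensor Xh"
begin

definition Uf :: "'a \<times> 'b \<times> 'c \<Rightarrow> ereal" where "Uf = (\<lambda>(r, s, t). U $ r $ s $ t)"

text \<open>Only entries with a finite upper bound carry a constraint, so only these entries of
  \<open>W\<close> become variables of the abstract program.\<close>

definition T :: "('a \<times> 'b \<times> 'c) set" where "T = {k. Uf k \<noteq> \<infinity>}"

definition M :: "('a, 'b, 'c) tensor" where "M = C - \<epsilon> *\<^sub>R tmap ln S"

definition Mt :: "('a, 'b, 'c) tensor" where "Mt = tmap exp (- ((1 / \<epsilon>) *\<^sub>R M))"

definition I :: "(nat \<times> nat) set" where "I = (SIGMA i:{1..N}. {1..m i})"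

definition P :: "(nat \<times> nat + 'a \<times> 'b \<times> 'c) set" where "P = Inl ` I \<union> Inr ` T"

text \<open>The factor \<open>1 / \<epsilon>\<close>, also present in \<open>rhs\<close>, makes
  \<open>F\<close> the dual objective divided by \<open>\<epsilon>\<close>.\<close>

definition col :: "nat \<times> nat + 'a \<times> 'b \<times> 'c \<Rightarrow> 'a \<times> 'b \<times> 'c \<Rightarrow> real"
  where "col p k = (case p of Inl (i, j) \<Rightarrow> entry (A i j) k / \<epsilon> | Inr k' \<Rightarrow> if k = k' then 1 / \<epsilon> else 0)"

definition rhs :: "nat \<times> nat + 'a \<times> 'b \<times> 'c \<Rightarrow> real"
  where "rhs p = (case p of Inl (i, j) \<Rightarrow> b i j / \<epsilon> | Inr k \<Rightarrow> real_of_ereal (Uf k) / \<epsilon>)"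

lemma col_simps [simp]: "col (Inl (i, j)) k = entry (A i j) k / \<epsilon>" "col (Inr k') k = (if k = k' then 1 / \<epsilon> else 0)"
  unfolding col_def by auto

lemma rhs_simps [simp]: "rhs (Inl (i, j)) = b i j / \<epsilon>" "rhs (Inr k) = real_of_ereal (Uf k) / \<epsilon>"
  unfolding rhs_def by auto

lemma Uf_cases: "k \<in> T \<Longrightarrow> Uf k = ereal (real_of_ereal (Uf k))" "k \<notin> T \<Longrightarrow> Uf k = \<infinity>"
proof -
  show "Uf k = ereal (real_of_ereal (Uf k))" if "k \<in> T"
    using that upper unfolding upper_bound_tensor_def T_def Uf_def
    by (cases k) (auto, metis real_of_ereal.simps(1))
qed (auto simp: T_def)

lemma bounded_above_iff: "bounded_above_by X U \<longleftrightarrow> (\<forall>k\<in>T. entry X k \<le> real_of_ereal (Uf k))"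
proof -
  have "bounded_above_by X U \<longleftrightarrow> (\<forall>k. ereal (entry X k) \<le> Uf k)"
    unfolding bounded_above_by_iff Uf_def by auto
  also have "\<dots> \<longleftrightarrow> (\<forall>k\<in>T. entry X k \<le> real_of_ereal (Uf k))"
    using Uf_cases by (metis ereal_less_eq(1) ereal_less_eq(3))
  finally show ?thesis .
qed

lemma lin_map_iff: "i \<in> {1..N} \<Longrightarrow> lin_map (m i) (A i) X = b i \<longleftrightarrow> (\<forall>j\<in>{1..m i}. A i j \<bullet> X = b i j)"
  using b[of i] unfolding lin_map_def rvec_def fun_eq_iff by auto

definition satisfies :: "('a, 'b, 'c) tensor \<Rightarrow> bool"
  where "satisfies X \<longleftrightarrow> (\<forall>i\<in>{1..N}. lin_map (m i) (A i) X = b i) \<and> bounded_above_by X U"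

lemma col_Inl_sum: "(\<Sum>k\<in>UNIV. col (Inl (i, j)) k * entry X k) = (A i j \<bullet> X) / \<epsilon>"
  unfolding inner_entry by (simp add: sum_divide_distrib)

lemma col_Inr_sum: "(\<Sum>k\<in>UNIV. col (Inr k') k * entry X k) = entry X k' / \<epsilon>"
proof -
  have "(\<Sum>k\<in>UNIV. col (Inr k') k * entry X k) = (\<Sum>k\<in>UNIV. if k = k' then entry X k' / \<epsilon> else 0)"
    by (rule sum.cong) auto
  then show ?thesis by simp
qed

lemma satisfies_iff: "satisfies X \<longleftrightarrow>
   (\<forall>p\<in>Inl ` I. (\<Sum>k\<in>UNIV. col p k * entry X k) = rhs p) \<and>
   (\<forall>p\<in>Inr ` T. (\<Sum>k\<in>UNIV. col p k * entry X k) \<le> rhs p)"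
  using \<epsilon> unfolding satisfies_def bounded_above_iff I_def
  by (auto simp: lin_map_iff col_Inl_sum col_Inr_sum divide_le_cancel simp del: col_simps)

sublocale exp_program P "Inr ` T" col rhs "entry Mt" "entry Xh"
proof
  have "satisfies Xh" using Xh(1) unfolding feasible_set_def satisfies_def by auto
  then show "\<And>p. p \<in> P \<Longrightarrow> p \<notin> Inr ` T \<Longrightarrow> (\<Sum>k\<in>UNIV. col p k * entry Xh k) = rhs p"
    "\<And>p. p \<in> Inr ` T \<Longrightarrow> (\<Sum>k\<in>UNIV. col p k * entry Xh k) \<le> rhs p"
    unfolding satisfies_iff P_def by auto
  show "finite P" unfolding P_def I_def by auto
  show "Inr ` T \<subseteq> P" unfolding P_def by auto
  show "0 < entry Mt k" for k unfolding Mt_def by simp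
  show "0 < entry Xh k" for k using Xh(2) unfolding positive_tensor_iff by blast
qed

text \<open>The effective domain of the dual objective in \<open>W\<close>: a negative entry against
  an infinite bound makes the objective infinite, whereas a zero entry contributes nothing.\<close>

definition dual_domain :: "('a, 'b, 'c) tensor \<Rightarrow> bool"
  where "dual_domain W \<longleftrightarrow> W \<le> 0 \<and> (\<forall>k. k \<notin> T \<longrightarrow> entry W k = 0)"

lemma dual_domain_feasible: "dual_domain W \<Longrightarrow> feasible (encode y W)"
  unfolding dual_domain_def feasible_def tensor_le_0_iff by auto

lemma sum_P: "(\<Sum>p\<in>P. f p) = (\<Sum>i=1..N. \<Sum>j=1..m i. f (Inl (i, j))) + (\<Sum>k\<in>T. f (Inr k))"
proof -
  have "(\<Sum>p\<in>P. f p) = (\<Sum>p\<in>Inl ` I. f p) + (\<Sum>p\<in>Inr ` T. f p)"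
    unfolding P_def by (rule sum.union_disjoint) (auto simp: I_def)
  then show ?thesis unfolding I_def by (simp add: sum.reindex sum.Sigma case_prod_beta)
qed

lemma z_encode:
  assumes "dual_domain W"
  shows "z (encode y W) k = (entry W k + (\<Sum>i=1..N. entry (adjoint_map (m i) (A i) (y i)) k)) / \<epsilon>"
proof -
  have "(\<Sum>k'\<in>T. entry W k' * (if k = k' then 1 / \<epsilon> else 0)) = (\<Sum>k'\<in>T. if k' = k then entry W k / \<epsilon> else 0)"
    by (rule sum.cong) auto
  also have "\<dots> = entry W k / \<epsilon>" using assms unfolding dual_domain_def by (simp del: split_paired_All)
  finally show ?thesis unfolding z_def sum_P adjoint_map_def
    by (simp add: sum_divide_distrib add_divide_distrib)
qed

lemma extended_inner_eq: "extended_inner W U = (\<Sum>k\<in>UNIV. ereal (entry W k) * Uf k)"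
  unfolding extended_inner_def sum_triples entry_def Uf_def by (simp add: case_prod_beta)

lemma extended_inner_dual_domain:
  assumes "dual_domain W"
  shows "extended_inner W U = ereal (\<Sum>k\<in>T. entry W k * real_of_ereal (Uf k))"
proof -
  have "(\<Sum>k\<in>UNIV. ereal (entry W k) * Uf k) = (\<Sum>k\<in>UNIV. ereal (if k \<in> T then entry W k * real_of_ereal (Uf k) else 0))"
  proof (rule sum.cong)
    fix k
    show "ereal (entry W k) * Uf k = ereal (if k \<in> T then entry W k * real_of_ereal (Uf k) else 0)"
    proof (cases "k \<in> T")
      case True
      show ?thesis using True by (subst Uf_cases(1)) auto
    next
      case False
      then show ?thesis using assms unfolding dual_domain_def by (simp add: zero_ereal_def[symmetric] del: split_paired_All)
    qed
  qed simp
  then show ?thesis unfolding extended_inner_eq by (simp add: sum.If_cases)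
qed

text \<open>Some summand is \<open>- \<infinity>\<close>, and none is \<open>\<infinity>\<close>
  because \<open>W \<le> 0\<close>. The latter matters, since a single \<open>\<infinity>\<close>
  would dominate the sum on \<open>ereal\<close>.\<close>

lemma extended_inner_not_dual_domain:
  assumes "\<not> dual_domain W" "W \<le> 0"
  shows "extended_inner W U = - \<infinity>"
proof -
  obtain k where k: "k \<notin> T" "entry W k \<noteq> 0" using assms unfolding dual_domain_def by auto
  then have "entry W k < 0" using assms unfolding tensor_le_0_iff by (metis order_le_less)
  then have t: "ereal (entry W k) * Uf k = - \<infinity>" unfolding Uf_cases(2)[OF k(1)] by simp
  have "(\<Sum>k\<in>UNIV - {k}. ereal (entry W k) * Uf k) \<noteq> \<infinity>"
    unfolding sum_Pinfty
  proof (rule notI, elim conjE bexE)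
    fix k' assume inf: "ereal (entry W k') * Uf k' = \<infinity>"
    have "entry W k' \<le> 0" using assms unfolding tensor_le_0_iff by blast
    moreover have "\<exists>u. Uf k' = ereal u" if "k' \<in> T" using Uf_cases(1)[OF that] by blast
    ultimately show False using inf Uf_cases(2)[of k']
      by (cases "k' \<in> T"; cases "entry W k' = 0") (auto simp: zero_ereal_def[symmetric])
  qed
  then show ?thesis unfolding extended_inner_eq
    using t by (subst sum.remove[of _ k]) auto
qed

text \<open>The bridge to the abstract program: minimizing the dual objective, fully or in one
  block, becomes minimizing \<open>F\<close> over feasible vectors.\<close>

lemma dual_obj_eq: "dual_obj Mt \<epsilon> N m A b U y W = (if dual_domain W then ereal (\<epsilon> * F (encode y W)) else \<infinity>)"
proof (cases "dual_domain W")
  case True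
  have 1: "Mt \<bullet> tmap exp ((1 / \<epsilon>) *\<^sub>R (W + (\<Sum>i=1..N. adjoint_map (m i) (A i) (y i))))
    = (\<Sum>k\<in>UNIV. entry Mt k * exp (z (encode y W) k))"
    unfolding inner_entry z_encode[OF True] by simp
  have 2: "(\<Sum>p\<in>P. encode y W p * rhs p)
    = ((\<Sum>i=1..N. \<Sum>j=1..m i. y i j * b i j) + (\<Sum>k\<in>T. entry W k * real_of_ereal (Uf k))) / \<epsilon>"
    unfolding sum_P by (simp add: sum_divide_distrib add_divide_distrib)
  have "indicator_nonpos W = 0" using True unfolding dual_domain_def indicator_nonpos_def by simp
  then show ?thesis unfolding dual_obj_def extended_inner_dual_domain[OF True] 1 F_def 2 using True \<epsilon>
    by (simp add: right_diff_distrib diff_diff_eq)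
next
  case False
  show ?thesis
  proof (cases "W \<le> 0")
    case True
    then show ?thesis using False extended_inner_not_dual_domain[OF False True]
      unfolding dual_obj_def indicator_nonpos_def by simp
  qed (use False in \<open>simp add: dual_obj_def indicator_nonpos_def\<close>)
qed

section \<open>Dual and primal optimality of decoded minimizers\<close>

definition decode_y :: "(nat \<times> nat + 'a \<times> 'b \<times> 'c \<Rightarrow> real) \<Rightarrow> nat \<Rightarrow> nat \<Rightarrow> real"
  where "decode_y x = (\<lambda>i j. if (i, j) \<in> I then x (Inl (i, j)) else 0)"

text \<open>Like \<open>decode_y\<close>, this fills the missing coordinates with 0, as
  \<open>dual_domain\<close> and \<open>blocks\<close> require.\<close>

definition decode_W :: "(nat \<times> nat + 'a \<times> 'b \<times> 'c \<Rightarrow> real) \<Rightarrow> ('a, 'b, 'c) tensor"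
  where "decode_W x = of_entries (\<lambda>k. if k \<in> T then x (Inr k) else 0)"

lemma F_decode: "F (encode (decode_y x) (decode_W x)) = F x"
  by (rule F_cong) (auto simp: P_def decode_y_def decode_W_def)

lemma dual_domain_decode: "feasible x \<Longrightarrow> dual_domain (decode_W x)"
  unfolding feasible_def dual_domain_def decode_W_def tensor_le_0_iff by auto

lemma decode_y_blocks: "decode_y x \<in> blocks N m"
  unfolding blocks_def decode_y_def rvec_def I_def by auto

lemma dual_optimal_decode:
  assumes "feasible x" "\<And>v. feasible v \<Longrightarrow> F x \<le> F v"
  shows "dual_optimal Mt \<epsilon> N m A b U (decode_y x, decode_W x)"
proof -
  have "dual_obj Mt \<epsilon> N m A b U (decode_y x) (decode_W x) \<le> dual_obj Mt \<epsilon> N m A b U y W" for y W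
    unfolding dual_obj_eq F_decode using assms dual_domain_feasible dual_domain_decode \<epsilon> by auto
  then show ?thesis unfolding dual_optimal_def is_arg_min_def
    using decode_y_blocks by (auto simp: not_less)
qed

text \<open>The gradient of \<open>F\<close> is the primal residual of \<open>Xs\<close>, so the
  optimality conditions of \<open>x\<close> make \<open>Xs\<close> feasible. Optimality follows from
  \<open>minimizer_primal_gap\<close> and convexity of the entropy; a competitor with a negative
  entry has infinite objective.\<close>

lemma primal_optimal_minimizer:
  assumes "feasible x" "\<And>v. feasible v \<Longrightarrow> F x \<le> F v"
  defines "Xs \<equiv> of_entries (\<lambda>k. entry Mt k * exp (z x k))"
  shows "primal_optimal C \<epsilon> S N m A b U Xs"
proof -
  have Xpos: "0 < entry Xs k" for k unfolding Xs_def using \<mu>[of k] by simp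
  have X0: "0 \<le> Xs" unfolding tensor_ge_0_iff using Xpos less_imp_le by blast
  have G: "G x p = (\<Sum>k\<in>UNIV. col p k * entry Xs k) - rhs p" for p unfolding G_def Xs_def by simp
  have "satisfies Xs" unfolding satisfies_iff
  proof (intro conjI ballI)
    fix p :: "nat \<times> nat + 'a \<times> 'b \<times> 'c" assume "p \<in> Inl ` I"
    then have "p \<in> P" "p \<notin> Inr ` T" unfolding P_def by auto
    then show "(\<Sum>k\<in>UNIV. col p k * entry Xs k) = rhs p"
      using minimizer_kkt(1)[OF assms(1,2), of p] unfolding G by linarith
  next
    fix p :: "nat \<times> nat + 'a \<times> 'b \<times> 'c" assume "p \<in> Inr ` T"
    then have "p \<in> P" "p \<in> Inr ` T" unfolding P_def by auto
    then show "(\<Sum>k\<in>UNIV. col p k * entry Xs k) \<le> rhs p"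
      using minimizer_kkt(2)[OF assms(1,2), of p] unfolding G by linarith
  qed
  moreover have "primal_obj C \<epsilon> S Xs \<le> primal_obj C \<epsilon> S Z" if Z: "satisfies Z" for Z
  proof (cases "0 \<le> Z")
    case False
    then show ?thesis unfolding primal_obj_eq[OF S \<epsilon>] by simp
  next
    case True
    \<comment> \<open>The left side is the gradient of the primal objective at \<open>Xs\<close>. By
      the choice of \<open>Xs\<close> it lies in the range of the adjoint constraint map.\<close>
    have lnX: "M + \<epsilon> *\<^sub>R tmap ln Xs = of_entries (\<lambda>k. \<epsilon> * z x k)"
      unfolding tensor_eq_iff
    proof
      fix k
      have "ln (entry Xs k) = - entry M k / \<epsilon> + z x k"
        unfolding Xs_def Mt_def by (simp add: exp_add[symmetric])
      then show "entry (M + \<epsilon> *\<^sub>R tmap ln Xs) k = entry (of_entries (\<lambda>k. \<epsilon> * z x k)) k"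
        using \<epsilon> by (simp add: field_simps)
    qed
    have "0 \<le> \<epsilon> * (\<Sum>k\<in>UNIV. z x k * (entry Z k - entry Mt k * exp (z x k)))"
    proof (intro mult_nonneg_nonneg minimizer_primal_gap[OF assms(1,2)])
      show "0 \<le> \<epsilon>" using \<epsilon> by simp
      show "\<And>p. p \<in> P \<Longrightarrow> p \<notin> Inr ` T \<Longrightarrow> (\<Sum>k\<in>UNIV. col p k * entry Z k) = rhs p"
        "\<And>p. p \<in> Inr ` T \<Longrightarrow> (\<Sum>k\<in>UNIV. col p k * entry Z k) \<le> rhs p"
        using Z unfolding satisfies_iff P_def by auto
    qed auto
    also have "\<dots> = (M + \<epsilon> *\<^sub>R tmap ln Xs) \<bullet> (Z - Xs)"
      unfolding lnX inner_entry by (simp add: Xs_def sum_distrib_left mult.assoc)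
    also have "\<dots> = M \<bullet> (Z - Xs) + \<epsilon> * (tmap ln Xs \<bullet> (Z - Xs))" by (simp add: inner_add_left)
    also have "\<dots> \<le> M \<bullet> (Z - Xs) + \<epsilon> * (entropy_sum Z - entropy_sum Xs)"
      using \<epsilon> by (intro add_left_mono mult_left_mono entropy_sum_gradient_ineq True Xpos) auto
    finally show ?thesis unfolding primal_obj_eq[OF S \<epsilon>] M_def using True X0
      by (simp add: inner_diff_left inner_diff_right algebra_simps)
  qed
  ultimately show ?thesis unfolding primal_optimal_def is_arg_min_def satisfies_def by (auto simp: not_less)
qed

section \<open>Linear convergence of the dual iteration\<close>

lemma dual_norm_le:
  "dual_norm N m (y, W) \<le> (\<Sum>(i, j)\<in>I. \<bar>y i j\<bar>) + (\<Sum>k\<in>UNIV. \<bar>entry W k\<bar>)"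
proof -
  have "(\<Sum>i=1..N. \<Sum>j=1..m i. (y i j)\<^sup>2) = (\<Sum>(i, j)\<in>I. (y i j)\<^sup>2)"
    unfolding I_def by (simp add: sum.Sigma)
  then have "dual_norm N m (y, W) = sqrt ((\<Sum>(i, j)\<in>I. (y i j)\<^sup>2) + (norm W)\<^sup>2)"
    unfolding dual_norm_def by simp
  also have "\<dots> \<le> sqrt (\<Sum>(i, j)\<in>I. (y i j)\<^sup>2) + sqrt ((norm W)\<^sup>2)"
    by (intro sqrt_add_le_add_sqrt sum_nonneg) auto
  also have "sqrt (\<Sum>(i, j)\<in>I. (y i j)\<^sup>2) \<le> (\<Sum>(i, j)\<in>I. \<bar>y i j\<bar>)"
    using L2_set_le_sum_abs[of "\<lambda>(i, j). y i j" I] by (simp add: L2_set_def case_prod_beta)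
  finally show ?thesis using norm_le_sum_entries[of W] by simp
qed

text \<open>The encoded iterates form a block descent with \<open>Suc N\<close> blocks,
  \<open>W\<close> being the last one. Coordinatewise rates are summed to rates in the
  norms.\<close>

theorem dual_bcd_linear:
  assumes "dual_bcd_sequence Mt \<epsilon> N m A b U y W"
  shows "\<exists>p. dual_optimal Mt \<epsilon> N m A b U p \<and> R_linearly_converges (dual_norm N m) (\<lambda>l. (y l, W l)) p"
    and "\<exists>Xs. primal_optimal C \<epsilon> S N m A b U Xs \<and> R_linearly_converges norm
      (\<lambda>l. tmap exp ((1 / \<epsilon>) *\<^sub>R ((\<Sum>i=1..N. adjoint_map (m i) (A i) (y l i)) + W l - M))) Xs"
proof -
  have y: "y l \<in> blocks N m" for l using assms unfolding dual_bcd_sequence_def by auto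
  define yy where "yy l i v = (\<lambda>k. if k < i then y (Suc l) k else if k = i then v else y l k)" for l i v
  have y_min: "is_unique_arg_min (\<lambda>v. dual_obj Mt \<epsilon> N m A b U (yy l i v) (W l)) (rvec (m i)) (y (Suc l) i)"
    if "i \<in> {1..N}" for l i using assms that unfolding dual_bcd_sequence_def yy_def by blast
  have W_min: "is_unique_arg_min (\<lambda>V. dual_obj Mt \<epsilon> N m A b U (y (Suc l)) V) UNIV (W (Suc l))" for l
    using assms unfolding dual_bcd_sequence_def by blast
  have zero_dom: "dual_domain 0" unfolding dual_domain_def by simp
  \<comment> \<open>The start has finite value by assumption; every later \<open>W\<close> does at
    least as well as \<open>W = 0\<close>, whose value is finite.\<close>
  have W_dom: "dual_domain (W l)" for l
  proof (cases l)
    case 0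
    then show ?thesis using assms unfolding dual_bcd_sequence_def dual_obj_eq by (auto split: if_splits)
  next
    case (Suc l')
    have "dual_obj Mt \<epsilon> N m A b U (y (Suc l')) (W (Suc l')) \<le> dual_obj Mt \<epsilon> N m A b U (y (Suc l')) 0"
      by (rule is_unique_arg_min_le[OF W_min UNIV_I])
    then show ?thesis using zero_dom Suc unfolding dual_obj_eq by (auto split: if_splits)
  qed
  define x where "x l = encode (y l) (W l)" for l
  define blk :: "nat \<times> nat + 'a \<times> 'b \<times> 'c \<Rightarrow> nat" where "blk p = (case p of Inl (i, j) \<Rightarrow> i | Inr k \<Rightarrow> Suc N)" for p
  have blk_simps [simp]: "blk (Inl (i, j)) = i" "blk (Inr k) = Suc N" for i j k unfolding blk_def by auto
  have feas_x: "feasible (x l)" for l unfolding x_def using W_dom by (rule dual_domain_feasible)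
  \<comment> \<open>If \<open>A i j\<close> vanished, feasibility of \<open>Xh\<close> would force
    \<open>b i j = 0\<close>. Raising coordinate \<open>j\<close> of the block by 1 would then give
    a second minimizer in the first sweep, against uniqueness.\<close>
  have A_nonzero: "\<exists>k. entry (A i j) k \<noteq> 0" if ij: "i \<in> {1..N}" "j \<in> {1..m i}" for i j
  proof (rule ccontr)
    assume "\<not> ?thesis"
    then have zero: "entry (A i j) k = 0" for k by blast
    then have "A i j \<bullet> Xh = 0" unfolding inner_entry by simp
    then have bz: "b i j = 0"
      using Xh(1) lin_map_iff[OF ij(1), of Xh] ij unfolding feasible_set_def by auto
    define v where "v = (y (Suc 0) i)(j := y (Suc 0) i j + 1)"
    have y1: "y (Suc 0) i \<in> rvec (m i)" using y[of "Suc 0"] ij(1) unfolding blocks_def by auto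
    then have v: "v \<in> rvec (m i)" using ij(2) unfolding v_def rvec_def by auto
    define f where "f v = dual_obj Mt \<epsilon> N m A b U (yy 0 i v) (W 0)" for v
    have "F (encode (yy 0 i v) (W 0)) = F (encode (yy 0 i (y (Suc 0) i)) (W 0))"
      by (rule F_cong_zero_columns) (auto simp: P_def yy_def v_def bz zero split: if_splits)
    then have "f v = f (y (Suc 0) i)" unfolding f_def dual_obj_eq by simp
    moreover have "is_unique_arg_min f (rvec (m i)) (y (Suc 0) i)"
      using y_min[OF ij(1), of 0] unfolding f_def .
    ultimately have "v = y (Suc 0) i"
      using v unfolding is_unique_arg_min_def is_arg_min_def by metis
    then have "v j = y (Suc 0) i j" by simp
    then show False unfolding v_def by simp
  qed
  have nonzero: "\<exists>k. col p k \<noteq> 0" if "p \<in> P" for p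
  proof (cases p)
    case (Inl ij)
    then obtain i j where p: "p = Inl (i, j)" by (cases ij) auto
    then show ?thesis using A_nonzero[of i j] that \<epsilon> by (auto simp: P_def I_def)
  next
    case (Inr k)
    then show ?thesis using \<epsilon> by (intro exI[of _ k]) simp
  qed
  have orth: "col p k * col q k = 0" if pq: "p \<in> P" "q \<in> P" "p \<noteq> q" "blk p = blk q" for p q k
  proof (cases p)
    case (Inl ij)
    then obtain i j where p: "p = Inl (i, j)" by (cases ij) auto
    then have i: "i \<in> {1..N}" "j \<in> {1..m i}" using that(1) by (auto simp: P_def I_def)
    have "\<exists>j'. q = Inl (i, j') \<and> j' \<in> {1..m i} \<and> j \<noteq> j'"
      using pq(2-4) p i(1) by (auto simp: P_def I_def)
    then obtain j' where q: "q = Inl (i, j')" "j' \<in> {1..m i}" "j \<noteq> j'" by blast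
    have "entry (A i j * A i j') k = 0" using orthogonal[OF i q(2,3)] by simp
    then show ?thesis unfolding p q(1) by simp
  next
    case (Inr k')
    then show ?thesis using pq by (auto simp: P_def I_def split: if_splits)
  qed
  \<comment> \<open>A competitor \<open>v\<close> is known only on \<open>P\<close>. Decoding its
    block \<open>i\<close> yields an admissible competitor for the actual update with the same value
    of \<open>F\<close>.\<close>
  have opt: "F (\<lambda>p. if blk p \<le> i then x (Suc l) p else x l p) \<le> F v"
    if i: "i \<in> {1..Suc N}" and v: "feasible v" and
      off: "\<And>p. p \<in> P \<Longrightarrow> blk p \<noteq> i \<Longrightarrow> v p = (if blk p \<le> i then x (Suc l) p else x l p)" for i l v
  proof (cases "i = Suc N")
    case True
    have "F (\<lambda>p. if blk p \<le> i then x (Suc l) p else x l p) = F (encode (y (Suc l)) (W (Suc l)))"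
      by (rule F_cong) (use True in \<open>auto simp: x_def P_def I_def\<close>)
    moreover have "F v = F (encode (y (Suc l)) (decode_W v))"
      by (rule F_cong) (use off True in \<open>auto simp: x_def P_def I_def decode_W_def\<close>)
    moreover have "dual_obj Mt \<epsilon> N m A b U (y (Suc l)) (W (Suc l)) \<le> dual_obj Mt \<epsilon> N m A b U (y (Suc l)) (decode_W v)"
      by (rule is_unique_arg_min_le[OF W_min UNIV_I])
    ultimately show ?thesis using W_dom dual_domain_decode[OF v] \<epsilon> unfolding dual_obj_eq by simp
  next
    case False
    then have i: "i \<in> {1..N}" using that by auto
    define V where "V = decode_y v i"
    have V: "V \<in> rvec (m i)" unfolding V_def decode_y_def rvec_def I_def by auto
    have "F (\<lambda>p. if blk p \<le> i then x (Suc l) p else x l p) = F (encode (yy l i (y (Suc l) i)) (W l))"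
      by (rule F_cong) (use i in \<open>auto simp: x_def P_def I_def yy_def\<close>)
    moreover have "F v = F (encode (yy l i V) (W l))"
      by (rule F_cong) (use off i in \<open>auto simp: x_def P_def I_def yy_def V_def decode_y_def\<close>)
    moreover have "dual_obj Mt \<epsilon> N m A b U (yy l i (y (Suc l) i)) (W l) \<le> dual_obj Mt \<epsilon> N m A b U (yy l i V) (W l)"
      by (rule is_unique_arg_min_le[OF y_min[OF i] V])
    ultimately show ?thesis using W_dom \<epsilon> unfolding dual_obj_eq by simp
  qed
  obtain x0 c q where x0: "feasible x0" "\<And>v. feasible v \<Longrightarrow> F x0 \<le> F v"
    and cq: "0 < c" "0 < q" "q < 1"
    and conv: "\<And>l p. p \<in> P \<Longrightarrow> \<bar>x l p - x0 p\<bar> \<le> c * q ^ l"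
      "\<And>l k. \<bar>entry Mt k * exp (z (x l) k) - entry Mt k * exp (z x0 k)\<bar> \<le> c * q ^ l"
  proof (rule block_descent_linear[of blk "Suc N" x])
    show "blk p \<in> {1..Suc N}" if "p \<in> P" for p using that by (auto simp: P_def I_def)
    show "col p k * col q k = 0" if "p \<in> P" "q \<in> P" "p \<noteq> q" "blk p = blk q" for p q k
      using that by (rule orth)
    show "\<exists>k. col p k \<noteq> 0" if "p \<in> P" for p using that by (rule nonzero)
    show "feasible (x l)" for l by (rule feas_x)
    show "F (\<lambda>p. if blk p \<le> i then x (Suc l) p else x l p) \<le> F v"
      if "i \<in> {1..Suc N}" "feasible v"
        "\<And>p. p \<in> P \<Longrightarrow> blk p \<noteq> i \<Longrightarrow> v p = (if blk p \<le> i then x (Suc l) p else x l p)" for i l v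
      using that by (rule opt)
  qed (rule that)
  have cq0: "0 \<le> c * q ^ l" for l using cq by simp
  have "R_linearly_converges (dual_norm N m) (\<lambda>l. (y l, W l)) (decode_y x0, decode_W x0)"
    unfolding R_linearly_converges_def
  proof (intro exI conjI allI)
    show "0 < (real (card I) + real CARD('a \<times> 'b \<times> 'c)) * c" using cq(1) by (simp add: add_nonneg_pos)
    fix l
    have "dual_norm N m (y l - decode_y x0, W l - decode_W x0)
      \<le> (\<Sum>(i, j)\<in>I. \<bar>y l i j - decode_y x0 i j\<bar>) + (\<Sum>k\<in>UNIV. \<bar>entry (W l - decode_W x0) k\<bar>)"
      using dual_norm_le[of "y l - decode_y x0" "W l - decode_W x0"] by simp
    also have "(\<Sum>(i, j)\<in>I. \<bar>y l i j - decode_y x0 i j\<bar>) \<le> real (card I) * (c * q ^ l)"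
    proof (rule sum_bounded_above, clarify)
      fix i j assume ij: "(i, j) \<in> I"
      then have "\<bar>x l (Inl (i, j)) - x0 (Inl (i, j))\<bar> \<le> c * q ^ l" by (intro conv) (auto simp: P_def)
      then show "\<bar>y l i j - decode_y x0 i j\<bar> \<le> c * q ^ l" using ij by (simp add: x_def decode_y_def)
    qed
    also have "(\<Sum>k\<in>UNIV. \<bar>entry (W l - decode_W x0) k\<bar>) \<le> real CARD('a \<times> 'b \<times> 'c) * (c * q ^ l)"
    proof (rule sum_bounded_above)
      fix k
      show "\<bar>entry (W l - decode_W x0) k\<bar> \<le> c * q ^ l"
      proof (cases "k \<in> T")
        case True
        then have "\<bar>x l (Inr k) - x0 (Inr k)\<bar> \<le> c * q ^ l" by (intro conv) (auto simp: P_def)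
        then show ?thesis using True by (simp add: x_def decode_W_def)
      next
        case False
        then show ?thesis using W_dom[of l] cq0[of l] unfolding dual_domain_def by (simp add: decode_W_def del: split_paired_All)
      qed
    qed
    finally show "dual_norm N m ((y l, W l) - (decode_y x0, decode_W x0))
      \<le> (real (card I) + real CARD('a \<times> 'b \<times> 'c)) * c * q ^ l"
      by (simp add: algebra_simps)
  qed (use cq in auto)
  with dual_optimal_decode[OF x0]
  show "\<exists>p. dual_optimal Mt \<epsilon> N m A b U p \<and> R_linearly_converges (dual_norm N m) (\<lambda>l. (y l, W l)) p"
    by blast
  define X where "X l = tmap exp ((1 / \<epsilon>) *\<^sub>R ((\<Sum>i=1..N. adjoint_map (m i) (A i) (y l i)) + W l - M))" for l
  define Xs :: "('a, 'b, 'c) tensor" where "Xs = of_entries (\<lambda>k. entry Mt k * exp (z x0 k))"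
  \<comment> \<open>Since \<open>Mt\<close> holds the exponentials of
    \<open>- M / \<epsilon>\<close>, the primal iterates are exactly the weighted exponentials whose
    rate the abstract theorem provides.\<close>
  have X: "entry (X l) k = entry Mt k * exp (z (x l) k)" for l k
    unfolding X_def Mt_def x_def z_encode[OF W_dom] by (simp add: exp_add[symmetric] add_divide_distrib diff_divide_distrib)
  have "R_linearly_converges norm X Xs" unfolding R_linearly_converges_def
  proof (intro exI conjI allI)
    show "0 < real CARD('a \<times> 'b \<times> 'c) * c" using cq(1) by simp
    fix l
    have "norm (X l - Xs) \<le> (\<Sum>k\<in>UNIV. \<bar>entry (X l - Xs) k\<bar>)" by (rule norm_le_sum_entries)
    also have "\<dots> \<le> real CARD('a \<times> 'b \<times> 'c) * (c * q ^ l)"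
      by (rule sum_bounded_above) (use conv(2) in \<open>simp add: X Xs_def\<close>)
    finally show "norm (X l - Xs) \<le> real CARD('a \<times> 'b \<times> 'c) * c * q ^ l" by simp
  qed (use cq in auto)
  with primal_optimal_minimizer[OF x0]
  show "\<exists>Xs. primal_optimal C \<epsilon> S N m A b U Xs \<and> R_linearly_converges norm
      (\<lambda>l. tmap exp ((1 / \<epsilon>) *\<^sub>R ((\<Sum>i=1..N. adjoint_map (m i) (A i) (y l i)) + W l - M))) Xs"
    unfolding Xs_def X_def by blast
qed

end

theorem theorem2:
  fixes C S M Mt :: "('a::finite, 'b::finite, 'c::finite) tensor"
    and \<epsilon> :: real
    and U :: "('a, 'b, 'c) etensor"
    and N :: nat
    and m :: "nat \<Rightarrow> nat"
    and A :: "nat \<Rightarrow> nat \<Rightarrow> ('a, 'b, 'c) tensor"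
    and b :: "nat \<Rightarrow> nat \<Rightarrow> real"
    and y :: "nat \<Rightarrow> nat \<Rightarrow> nat \<Rightarrow> real"
    and W X :: "nat \<Rightarrow> ('a, 'b, 'c) tensor"
  assumes "upper_bound_tensor U"
    and "\<forall>i\<in>{1..N}. b i \<in> rvec (m i)"
    and "\<forall>i\<in>{1..N}. \<forall>j\<in>{1..m i}. \<forall>r s t. A i j $ r $ s $ t \<in> {0, 1}"
    and "\<forall>i\<in>{1..N}. \<forall>j\<in>{1..m i}. \<forall>k\<in>{1..m i}. j \<noteq> k \<longrightarrow> A i j * A i k = 0"
    and "positive_tensor S"
    and "\<epsilon> > 0"
    and "M = C - \<epsilon> *\<^sub>R tmap ln S"
    and "Mt = tmap exp (- ((1 / \<epsilon>) *\<^sub>R M))"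
    and "bounded (feasible_set N m A b U)"
    and "feasible_set N m A b U \<inter> {Z. positive_tensor Z} \<noteq> {}"
    and "dual_bcd_sequence Mt \<epsilon> N m A b U y W"
    and "\<forall>l. X l = tmap exp ((1 / \<epsilon>) *\<^sub>R ((\<Sum>i=1..N. adjoint_map (m i) (A i) (y l i)) + W l - M))"
  shows "(\<exists>p. dual_optimal Mt \<epsilon> N m A b U p \<and>
              R_linearly_converges (dual_norm N m) (\<lambda>l. (y l, W l)) p) \<and>
         (\<exists>Xs. primal_optimal C \<epsilon> S N m A b U Xs \<and> R_linearly_converges norm X Xs)"
proof -
  \<comment> \<open>This strictly positive feasible point becomes the interior point
    \<open>xh\<close> of the abstract program.\<close>
  obtain Xh where Xh: "Xh \<in> feasible_set N m A b U" "positive_tensor Xh"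
    using assms(10) by blast
  interpret tp: tensor_program C S \<epsilon> U N m A b Xh
    by unfold_locales (use assms(1,2,4,5,6) Xh in \<open>blast+\<close>)
  have M: "tp.M = M" unfolding tp.M_def assms(7) ..
  have Mt: "tp.Mt = Mt" unfolding tp.Mt_def M assms(8) ..
  have X: "X = (\<lambda>l. tmap exp ((1 / \<epsilon>) *\<^sub>R ((\<Sum>i=1..N. adjoint_map (m i) (A i) (y l i)) + W l - M)))"
    using assms(12) by blast
  show ?thesis
    using tp.dual_bcd_linear[of y W] assms(11) unfolding M Mt X by blast
qed

end
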